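(* Let $0<\alpha<2$, $0<\beta\le1$, let $B_{\alpha,\beta}$ be grey Brownian motion, let $n\in\mathbb{N}$, $0\le t_1<t_2<\dots<t_n<\infty$, and $\mathbf{B}_{\alpha,\beta}=(B_{\alpha,\beta}(t_1),\dots,B_{\alpha,\beta}(t_n))$. Let $\Sigma_\alpha=(a_{i,j})_{i,j=1}^n$ with $a_{i,j}=\frac12\big(t_i^\alpha+t_j^\alpha-|t_i-t_j|^\alpha\big)$. Then $\mathbf{B}_{\alpha,\beta}$ has the multivariate elliptical distribution $E_n(0,\Sigma_\alpha,E_\beta(-\,\cdot\,))$, with associated density generator $$g_\beta(x)=\frac1{(2\pi)^{n/2}}\int_0^\infty\tau^{-n/2}e^{-x/\tau}M_\beta(\tau)\,d\tau ,$$ which satisfies $$\int_0^\infty x^{n/2-1}g_\beta(x)\,dx=(2\pi)^{-n/2}\,\Gamma\left(\frac n2\right)<\infty .$$ Furthermore, $\mathbf{B}_{\alpha,\beta}$ may be represented by $\mathbf{B}_{\alpha,\beta}=R_\beta A_\alpha U$, where $R_\beta\ge0$ is a radial random variable, $A_\alpha$ is such that $\Sigma_\alpha=A_\alpha A_\alpha^\top$, and $U$ is the uniform distribution on the sphere $\{x\in\mathbb{R}^n:\|x\|=1\}$.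
   Context: $E_\beta(x)=\sum_{n\ge0}x^n/\Gamma(\beta n+1)$ is the Mittag-Leffler function, and $M_\beta$ is the M-Wright probability density on $[0,\infty)$, determined by $\int_0^\infty e^{-s\tau}M_\beta(\tau)\,d\tau=E_\beta(-s)$, $s\ge0$ (for $\beta=1$, $M_\beta(\tau)\,d\tau$ is understood as the point mass at $1$). Grey Brownian motion $B_{\alpha,\beta}$ is the process whose finite-dimensional distributions are those of $\sqrt{Y_\beta}\,B_H(t)$, $t\ge0$, where $Y_\beta\ge0$ has density $M_\beta$ and $B_H$ is an independent standard fractional Brownian motion with Hurst parameter $H=\alpha/2$ (centered Gaussian with covariance $\frac12(t^{\alpha}+s^{\alpha}-|t-s|^{\alpha})$). A random vector $\mathbf{X}$ in $\mathbb{R}^n$ has the multivariate elliptical distribution $E_n(\mu,\Sigma,\phi)$, with $\mu\in\mathbb{R}^n$, $\Sigma$ a positive-definite matrix and $\phi$ the characteristic generator (such that $\phi(\theta_1^2+\dots+\theta_n^2)$ is an $n$-dimensional characteristic function), if $\mathbb{E}(e^{i\theta\cdot\mathbf{X}})=\exp(i\theta\cdot\mu)\,\phi\big(\frac12\theta^\top\Sigma\theta\big)$ for all $\theta\in\mathbb{R}^n$. If $\mathbf{X}$ has a probability density function $f_{\mathbf{X}}$, it is of the form $f_{\mathbf{X}}(x)=\frac{c}{\sqrt{\det\Sigma}}\,g\big(\frac12(x-\mu)^\top\Sigma^{-1}(x-\mu)\big)$ for a constant $c$ and a certain function $g$, called the density generator; the condition $\int_0^\infty x^{n/2-1}g(x)\,dx<\infty$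 is sufficient for $g$ to be a density generator.
   Formalization: If t_1=0, Σ_α has a zero row, so it is not positive definite and there is no density; positive definiteness and the density are claimed only for t_1>0, while for t_1=0 Σ_α is positive semidefinite and the characteristic function and the representation R A U in law still hold. *)

theory Defs
  imports "HOL-Probability.Probability"
begin

definition mittag_leffler :: "real \<Rightarrow> real \<Rightarrow> real" where
  "mittag_leffler \<beta> x = (\<Sum>n. x ^ n / Gamma (\<beta> * real n + 1))"

text \<open>The Laplace transform determines the M-Wright density up to null sets; \<open>s = 0\<close> gives total
  mass 1. Values at negative arguments are irrelevant.\<close>

definition M_Wright_density :: "real \<Rightarrow> (real \<Rightarrow> real) \<Rightarrow> bool" where
  "M_Wright_density \<beta> m \<longleftrightarrow>
     m \<in> borel_measurable borel \<and>
     (\<forall>\<tau>\<ge>0. 0 \<le> m \<tau>) \<and>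
     (\<forall>s\<ge>0. has_bochner_integral lborel
        (\<lambda>\<tau>. indicator {0..} \<tau> * (exp (- (s * \<tau>)) * m \<tau>)) (mittag_leffler \<beta> (- s)))"

definition M_Wright_law :: "real \<Rightarrow> (real \<Rightarrow> real) \<Rightarrow> real measure" where
  "M_Wright_law \<beta> m =
     (if \<beta> = 1 then return borel 1
      else density lborel (\<lambda>\<tau>. indicator {0..} \<tau> * ennreal (m \<tau>)))"

text \<open>Normal laws, including the degenerate ones with standard deviation 0.\<close>

definition normal_law :: "real \<Rightarrow> real \<Rightarrow> real measure" where
  "normal_law \<mu> \<sigma> =
     (if \<sigma> = 0 then return borel \<mu> else density lborel (\<lambda>x. ennreal (normal_density \<mu> \<sigma> x)))"

definition gaussian_process :: "'b measure \<Rightarrow> (real \<Rightarrow> 'b \<Rightarrow> real) \<Rightarrow> bool" where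
  "gaussian_process N W \<longleftrightarrow>
     (\<forall>t\<ge>0. W t \<in> borel_measurable N) \<and>
     (\<forall>J c. finite J \<and> J \<subseteq> {0..} \<longrightarrow>
        (\<exists>\<mu> \<sigma>. 0 \<le> \<sigma> \<and> distr N borel (\<lambda>\<omega>. \<Sum>t\<in>J. c t * W t \<omega>) = normal_law \<mu> \<sigma>))"

definition fBm_covariance :: "real \<Rightarrow> real \<Rightarrow> real \<Rightarrow> real" where
  "fBm_covariance \<alpha> t s = (t powr \<alpha> + s powr \<alpha> - \<bar>t - s\<bar> powr \<alpha>) / 2"

definition fractional_Brownian_motion ::
    "real \<Rightarrow> 'b measure \<Rightarrow> (real \<Rightarrow> 'b \<Rightarrow> real) \<Rightarrow> bool" where
  "fractional_Brownian_motion H N W \<longleftrightarrow>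
     gaussian_process N W \<and>
     (\<forall>t\<ge>0. (LINT \<omega>|N. W t \<omega>) = 0) \<and>
     (\<forall>t\<ge>0. \<forall>s\<ge>0. (LINT \<omega>|N. W t \<omega> * W s \<omega>) = fBm_covariance (2 * H) t s)"

text \<open>Unlike \<open>indep_var\<close>, this allows the two random variables to have different types.\<close>

definition independent_of ::
    "'a measure \<Rightarrow> 'b measure \<Rightarrow> ('a \<Rightarrow> 'b) \<Rightarrow> 'c measure \<Rightarrow> ('a \<Rightarrow> 'c) \<Rightarrow> bool" where
  "independent_of N S X T Z \<longleftrightarrow>
     X \<in> measurable N S \<and> Z \<in> measurable N T \<and>
     prob_space.indep_set N {X -` A \<inter> space N | A. A \<in> sets S} {Z -` A \<inter> space N | A. A \<in> sets T}"

definition same_finite_dim_distributions ::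
    "'a measure \<Rightarrow> (real \<Rightarrow> 'a \<Rightarrow> real) \<Rightarrow> 'b measure \<Rightarrow> (real \<Rightarrow> 'b \<Rightarrow> real) \<Rightarrow> bool" where
  "same_finite_dim_distributions P X N Z \<longleftrightarrow>
     (\<forall>J. finite J \<and> J \<subseteq> {0..} \<longrightarrow>
        distr P (Pi\<^sub>M J (\<lambda>_. borel)) (\<lambda>\<omega>. \<lambda>t\<in>J. X t \<omega>) =
        distr N (Pi\<^sub>M J (\<lambda>_. borel)) (\<lambda>\<omega>. \<lambda>t\<in>J. Z t \<omega>))"

text \<open>The representing triple \<open>N\<close>, \<open>Y\<close>, \<open>W\<close> is a parameter rather than existentially bound, since
  HOL cannot quantify over the type of the sample space of \<open>N\<close>.\<close>

definition grey_Brownian_motion ::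
    "real \<Rightarrow> real \<Rightarrow> (real \<Rightarrow> real) \<Rightarrow> 'a measure \<Rightarrow> (real \<Rightarrow> 'a \<Rightarrow> real) \<Rightarrow>
     'b measure \<Rightarrow> ('b \<Rightarrow> real) \<Rightarrow> (real \<Rightarrow> 'b \<Rightarrow> real) \<Rightarrow> bool" where
  "grey_Brownian_motion \<alpha> \<beta> m P B N Y W \<longleftrightarrow>
     prob_space P \<and> (\<forall>t\<ge>0. B t \<in> borel_measurable P) \<and>
     prob_space N \<and>
     Y \<in> borel_measurable N \<and> (AE \<omega> in N. 0 \<le> Y \<omega>) \<and> distr N borel Y = M_Wright_law \<beta> m \<and>
     fractional_Brownian_motion (\<alpha> / 2) N W \<and>
     independent_of N borel Y (Pi\<^sub>M {0..} (\<lambda>_. borel)) (\<lambda>\<omega>. \<lambda>t\<in>{0..}. W t \<omega>) \<and>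
     same_finite_dim_distributions P B N (\<lambda>t \<omega>. sqrt (Y \<omega>) * W t \<omega>)"

definition sample_vector :: "(real \<Rightarrow> 'a \<Rightarrow> real) \<Rightarrow> real ^ 'n \<Rightarrow> 'a \<Rightarrow> real ^ 'n" where
  "sample_vector B t \<omega> = (\<chi> i. B (t $ i) \<omega>)"

definition covariance_matrix :: "real \<Rightarrow> real ^ 'n \<Rightarrow> real ^ 'n ^ 'n" where
  "covariance_matrix \<alpha> t = (\<chi> i j. fBm_covariance \<alpha> (t $ i) (t $ j))"

definition positive_definite :: "real ^ 'n ^ 'n \<Rightarrow> bool" where
  "positive_definite S \<longleftrightarrow> transpose S = S \<and> (\<forall>x. x \<noteq> 0 \<longrightarrow> 0 < x \<bullet> (S *v x))"

definition positive_semidefinite :: "real ^ 'n ^ 'n \<Rightarrow> bool" where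
  "positive_semidefinite S \<longleftrightarrow> transpose S = S \<and> (\<forall>x. 0 \<le> x \<bullet> (S *v x))"

text \<open>\<open>\<phi>\<close> may be taken real-valued: \<open>\<theta> \<mapsto> \<phi> (\<theta> \<bullet> \<theta>)\<close> is even, and an even characteristic function
  is real.\<close>

definition characteristic_generator :: "'n::finite itself \<Rightarrow> (real \<Rightarrow> real) \<Rightarrow> bool" where
  "characteristic_generator _ \<phi> \<longleftrightarrow>
     (\<exists>\<nu> :: (real ^ 'n) measure. prob_space \<nu> \<and> sets \<nu> = sets borel \<and>
        (\<forall>\<theta>. (CLINT x|\<nu>. iexp (\<theta> \<bullet> x)) = complex_of_real (\<phi> (\<theta> \<bullet> \<theta>))))"

text \<open>Kept apart from \<open>elliptical_distribution\<close> because it also makes sense for singular \<open>S\<close>: a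
  sample at time 0 makes the covariance matrix singular.\<close>

definition elliptical_char_function ::
    "'a measure \<Rightarrow> ('a \<Rightarrow> real ^ 'n) \<Rightarrow> real ^ 'n \<Rightarrow> real ^ 'n ^ 'n \<Rightarrow> (real \<Rightarrow> real) \<Rightarrow> bool" where
  "elliptical_char_function P X \<mu> S \<phi> \<longleftrightarrow>
     X \<in> borel_measurable P \<and>
     (\<forall>\<theta>. (CLINT \<omega>|P. iexp (\<theta> \<bullet> X \<omega>)) =
        iexp (\<theta> \<bullet> \<mu>) * complex_of_real (\<phi> (\<theta> \<bullet> (S *v \<theta>) / 2)))"

definition elliptical_distribution ::
    "'a measure \<Rightarrow> ('a \<Rightarrow> real ^ 'n) \<Rightarrow> real ^ 'n \<Rightarrow> real ^ 'n ^ 'n \<Rightarrow> (real \<Rightarrow> real) \<Rightarrow> bool" where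
  "elliptical_distribution P X \<mu> S \<phi> \<longleftrightarrow>
     positive_definite S \<and> characteristic_generator TYPE('n) \<phi> \<and>
     elliptical_char_function P X \<mu> S \<phi>"

definition density_generator ::
    "'a measure \<Rightarrow> ('a \<Rightarrow> real ^ 'n) \<Rightarrow> real ^ 'n \<Rightarrow> real ^ 'n ^ 'n \<Rightarrow> (real \<Rightarrow> ennreal) \<Rightarrow> bool" where
  "density_generator P X \<mu> S g \<longleftrightarrow>
     (\<exists>c. distributed P lborel X
        (\<lambda>x. ennreal (c / sqrt (det S)) * g ((x - \<mu>) \<bullet> (matrix_inv S *v (x - \<mu>)) / 2)))"

text \<open>Extended-valued, because for \<open>n \<ge> 2\<close> and \<open>\<beta> < 1\<close> the integral diverges at \<open>x = 0\<close>.\<close>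

definition grey_density_generator ::
    "nat \<Rightarrow> real \<Rightarrow> (real \<Rightarrow> real) \<Rightarrow> real \<Rightarrow> ennreal" where
  "grey_density_generator n \<beta> m x =
     ennreal (1 / (2 * pi) powr (real n / 2)) *
     (\<integral>\<^sup>+\<tau>\<in>{0..}. ennreal (\<tau> powr (- (real n / 2)) * exp (- (x / \<tau>))) \<partial>M_Wright_law \<beta> m)"

text \<open>Normalised surface measure on the unit sphere, obtained as the radial projection of the
  uniform distribution on the unit ball: the mass of a set is proportional to the volume of the
  cone over it.\<close>

definition uniform_sphere :: "(real ^ 'n) measure" where
  "uniform_sphere = distr (uniform_measure lborel (ball 0 1)) borel (\<lambda>x. x /\<^sub>R norm x)"

definition radial_uniform_pair :: "'c measure \<Rightarrow> ('c \<Rightarrow> real) \<Rightarrow> ('c \<Rightarrow> real ^ 'n) \<Rightarrow> bool" where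
  "radial_uniform_pair Q R U \<longleftrightarrow>
     prob_space Q \<and>
     R \<in> borel_measurable Q \<and> (\<forall>\<omega>\<in>space Q. 0 \<le> R \<omega>) \<and>
     U \<in> borel_measurable Q \<and> distr Q borel U = uniform_sphere \<and>
     independent_of Q borel R borel U"

end

(* The law L of Y has Laplace transform s |-> E_beta(-s), so conditioning on Y gives every linear
   combination of the sampled process the characteristic function E_beta(-theta.S theta/2). A
   characteristic function on R^n determines the law, and for S = A A^T the same characteristic
   function belongs to sqrt(y) A z with y ~ L and z standard Gaussian, independent. Hence the sample is
   distributed as sqrt(y) A z: the density comes from a change of variables and Fubini, and the polar
   representation from the independence of the norm and the direction of z.

   S is positive definite at distinct positive times because a combination of zero variance is
   orthogonal to every W(s), and s |-> Cov(W(t_k), W(s)) on s > 0 fails to be smooth exactly at t_k. *)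

theory Submission
  imports Defs "HOL-Real_Asymp.Real_Asymp"
begin

section \<open>Characteristic functions on Euclidean spaces determine the law\<close>

text \<open>Three obstacles shape the development. Uniqueness on the line is a theorem about
  positive measures, while fixing one coordinate of a characteristic function leaves a complex
  weight \<open>iexp (\<theta> \<bullet> x)\<close>; the passage to several dimensions therefore
  works with the nonnegative weights \<open>1 + Re (z * iexp (\<theta> \<bullet> x))\<close>,
  \<open>cmod z \<le> 1\<close>. A sample at time 0 gives the covariance matrix a zero row, so a
  factor \<open>A\<close> has to be found for semidefinite matrices, by an elimination that skips
  zero pivots, and everything resting on an inverse of \<open>A\<close> is confined to positive
  times. The constant in a density generator is free, so the change of variables under
  \<open>A\<close> may produce an unspecified factor and no determinant is computed.

  The mixing law is treated abstractly, which handles the point mass at \<beta> = 1 together with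
  the densities for \<beta> < 1. It must not charge 0: there \<open>sqrt y *\<^sub>R z\<close> has
  no direction, and the Gaussian density with variance y, which the generator averages, does not
  exist.\<close>

lemma finite_measure_char_unique:
  fixes M1 M2 :: "real measure"
  assumes "finite_measure M1" "finite_measure M2"
    and [measurable_cong]: "sets M1 = sets borel" "sets M2 = sets borel"
    and char: "\<And>u. (CLINT x|M1. iexp (u * x)) = (CLINT x|M2. iexp (u * x))"
  shows "M1 = M2"
proof -
  interpret M1: finite_measure M1 by fact
  interpret M2: finite_measure M2 by fact
  have sp: "space M1 = UNIV" "space M2 = UNIV"
    using assms(3,4) by (auto dest: sets_eq_imp_space_eq)
  \<comment> \<open>Levy's theorem is about probability laws, so both measures are divided by their
    common mass, read off at frequency 0. Mass 0 cannot be normalised and is treated apart.\<close>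
  define c where "c = measure M1 UNIV"
  have c1: "emeasure M1 UNIV = ennreal c"
    unfolding c_def by (simp add: M1.emeasure_eq_measure)
  have "c = measure M2 UNIV"
    using char[of 0] by (simp add: sp c_def)
  then have c2: "emeasure M2 UNIV = ennreal c"
    by (simp add: M2.emeasure_eq_measure)
  have "c \<ge> 0" by (simp add: c_def)
  show ?thesis
  proof (cases "c = 0")
    case True
    show ?thesis
    proof (rule measure_eqI)
      fix X
      have "emeasure M1 X \<le> emeasure M1 (space M1)" "emeasure M2 X \<le> emeasure M2 (space M2)"
        by (rule emeasure_space)+
      then show "emeasure M1 X = emeasure M2 X"
        using True c1 c2 by (simp add: sp)
    qed (simp add: assms)
  next
    case False
    with \<open>c \<ge> 0\<close> have "c > 0" by simp
    let ?D = "\<lambda>M::real measure. density M (\<lambda>_. ennreal (1 / c))"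
    have D: "real_distribution (?D M)" if "emeasure M UNIV = ennreal c" "sets M = sets borel" for M
    proof -
      have "space M = UNIV" using that by (auto dest: sets_eq_imp_space_eq)
      then have "emeasure (?D M) (space (?D M)) = 1"
        using that \<open>c > 0\<close>
        by (subst emeasure_density) (auto simp: nn_integral_cmult_indicator ennreal_mult'[symmetric])
      then interpret prob_space "?D M" by (rule prob_spaceI)
      show ?thesis
        by unfold_locales (use that in \<open>auto simp: \<open>space M = UNIV\<close>\<close>)
    qed
    have "char (?D M1) = char (?D M2)"
      using \<open>c > 0\<close> char by (auto simp: char_def fun_eq_iff integral_density)
    then have eq: "?D M1 = ?D M2"
      by (intro Levy_uniqueness D c1 c2 assms)
    show ?thesis
    proof (rule measure_eqI)
      fix X assume X: "X \<in> sets M1"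
      then have "X \<in> sets M2" by (simp add: assms)
      have "ennreal (1/c) * emeasure M1 X = ennreal (1/c) * emeasure M2 X"
        using arg_cong[OF eq, of "\<lambda>M. emeasure M X"] X \<open>X \<in> sets M2\<close>
        by (simp add: emeasure_density nn_integral_cmult_indicator)
      then show "emeasure M1 X = emeasure M2 X"
        using \<open>c > 0\<close> by (simp add: ennreal_mult_cancel_left)
    qed (simp add: assms)
  qed
qed

text \<open>This is the one-dimensional theorem for the image under \<open>x \<bullet> b\<close> of
  the measure with density \<open>w\<close>. The bound 2 keeps that measure finite; it is the bound
  satisfied by a product of indicators times \<open>1 + h\<close> with
  \<open>\<bar>h\<bar> \<le> 1\<close>.\<close>

lemma weighted_coordinate_unique:
  fixes M1 M2 :: "'a::euclidean_space measure" and w :: "'a \<Rightarrow> real"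
  assumes "prob_space M1" "prob_space M2"
    and [measurable_cong]: "sets M1 = sets borel" "sets M2 = sets borel"
    and [measurable]: "w \<in> borel_measurable borel" "A \<in> sets borel"
    and w: "\<And>x. 0 \<le> w x" "\<And>x. w x \<le> 2"
    and char: "\<And>u. (CLINT x|M1. complex_of_real (w x) * iexp (u * (x \<bullet> b))) =
                    (CLINT x|M2. complex_of_real (w x) * iexp (u * (x \<bullet> b)))"
  shows "(LINT x|M1. w x * indicator A (x \<bullet> b)) = (LINT x|M2. w x * indicator A (x \<bullet> b))"
proof -
  let ?D = "\<lambda>M. distr (density M w) borel (\<lambda>x. x \<bullet> b)"
  have fin: "finite_measure (?D M)" if "prob_space M" and [measurable_cong]: "sets M = sets borel" for M
  proof -
    interpret prob_space M by fact
    have "(\<integral>\<^sup>+x. w x \<partial>M) \<le> (\<integral>\<^sup>+x. 2 \<partial>M)"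
      using w(2) by (intro nn_integral_mono) (metis ennreal_leI ennreal_numeral)
    then have "(\<integral>\<^sup>+x. w x \<partial>M) \<noteq> \<infinity>"
      by (auto simp: emeasure_space_1 top_unique)
    then have "finite_measure (density M w)"
      by (intro finite_measureI) (simp add: emeasure_density cong: nn_integral_cong)
    then show ?thesis
      by (rule finite_measure.finite_measure_distr) measurable
  qed
  have int: "(CLINT x|?D M. iexp (u * x)) = (CLINT x|M. complex_of_real (w x) * iexp (u * (x \<bullet> b)))"
    if [measurable_cong]: "sets M = sets borel" for M and u
    by (subst integral_distr) (auto simp: integral_density w scaleR_conv_of_real)
  have eq: "?D M1 = ?D M2"
    by (rule finite_measure_char_unique) (simp_all only: int fin assms sets_distr)
  have int': "(LINT x|?D M. indicator A x) = (LINT x|M. w x * indicator A (x \<bullet> b))"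
    if [measurable_cong]: "sets M = sets borel" for M
    by (subst integral_distr) (auto simp: integral_density w)
  show ?thesis
    using int'[of M1] int'[of M2] eq assms by simp
qed

lemma integral_lincomb3:
  fixes f g h :: "'a \<Rightarrow> complex"
  assumes "integrable M f" "integrable M g" "integrable M h"
  shows "(\<integral>x. f x + b * g x + c * h x \<partial>M) = integral\<^sup>L M f + b * integral\<^sup>L M g + c * integral\<^sup>L M h"
  using assms by simp

text \<open>Indicators of the coordinates are inserted one at a time, with a free factor
  \<open>iexp (\<theta> \<bullet> x)\<close> kept alongside so that the induction can continue. With
  all coordinates present and \<theta> = 0 this gives equality on boxes, an intersection-stable
  generator of the Borel sets.\<close>

lemma char_euclidean_unique:
  fixes M1 M2 :: "'a::euclidean_space measure"
  assumes "prob_space M1" "prob_space M2"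
    and [measurable_cong]: "sets M1 = sets borel" "sets M2 = sets borel"
    and char: "\<And>\<theta>. (CLINT x|M1. iexp (\<theta> \<bullet> x)) = (CLINT x|M2. iexp (\<theta> \<bullet> x))"
  shows "M1 = M2"
proof -
  interpret M1: prob_space M1 by fact
  interpret M2: prob_space M2 by fact
  let ?I = "\<lambda>J (A::'a \<Rightarrow> real set) x. \<Prod>j\<in>J. indicator (A j) (x \<bullet> j) :: real"
  have I01: "0 \<le> ?I J A x" "?I J A x \<le> 1" for J A x
    by (auto intro!: prod_nonneg prod_le_1 simp: indicator_def)
  have key: "(CLINT x|M1. complex_of_real (?I J A x) * iexp (\<theta> \<bullet> x)) =
             (CLINT x|M2. complex_of_real (?I J A x) * iexp (\<theta> \<bullet> x))"
    if "finite J" "\<And>j. A j \<in> sets borel" for J A \<theta>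
    using that
  proof (induction J arbitrary: \<theta> rule: finite_induct)
    case empty
    then show ?case by (simp add: char)
  next
    case (insert k J)
    note [measurable] = insert.prems
    have Im[measurable]: "?I J A \<in> borel_measurable borel" by measurable
    have IH: "(CLINT x|M1. complex_of_real (?I J A x) * iexp (\<theta> \<bullet> x)) =
             (CLINT x|M2. complex_of_real (?I J A x) * iexp (\<theta> \<bullet> x))" for \<theta>
      using insert by blast
    have bnd: "cmod (z * complex_of_real (?I J A x) * iexp y) \<le> cmod z" for z x y
      using I01[of A x J] by (simp add: norm_mult mult_left_le flip: of_real_prod)
    have int: "integrable M (\<lambda>x. z * (complex_of_real (?I J A x) * iexp (\<theta> \<bullet> x)))"
      if "prob_space M" and [measurable_cong]: "sets M = sets borel" for M z \<theta>
    proof -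
      interpret prob_space M by fact
      show ?thesis
        by (rule integrable_const_bound[where B="cmod z"])
           (use bnd in \<open>auto simp: mult.assoc\<close>)
    qed
    \<comment> \<open>The real function h stands in for the exponential: for
      \<open>cmod z \<le> 1\<close> it lies in [-1, 1], so \<open>1 + h\<close> is an admissible
      nonnegative weight.\<close>
    define h where "h z \<theta> x = Re (z * iexp (\<theta> \<bullet> x))" for z and \<theta> x :: 'a
    have hm[measurable]: "h z \<theta> \<in> borel_measurable borel" for z \<theta>
      unfolding h_def by measurable
    have hb: "\<bar>h z \<theta> x\<bar> \<le> 1" if "cmod z \<le> 1" for z \<theta> x
      unfolding h_def using abs_Re_le_cmod[of "z * iexp (\<theta> \<bullet> x)"] that by (simp add: norm_mult)
    have one: "(LINT x|M1. ?I J A x * (1 + h z \<theta> x) * indicator (A k) (x \<bullet> k)) =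
               (LINT x|M2. ?I J A x * (1 + h z \<theta> x) * indicator (A k) (x \<bullet> k))"
      if z: "cmod z \<le> 1" for z \<theta>
    proof (rule weighted_coordinate_unique)
      fix x :: 'a
      have "-1 \<le> h z \<theta> x" "h z \<theta> x \<le> 1" using hb[OF z, of \<theta> x] by auto
      then show "0 \<le> ?I J A x * (1 + h z \<theta> x)"
        using I01[of A x J] by (intro mult_nonneg_nonneg) auto
      have "?I J A x * (1 + h z \<theta> x) \<le> 1 * 2"
        by (rule mult_mono) (use I01[of A x J] \<open>-1 \<le> h z \<theta> x\<close> \<open>h z \<theta> x \<le> 1\<close> in auto)
      then show "?I J A x * (1 + h z \<theta> x) \<le> 2" by simp
    next
      fix u :: real
      \<comment> \<open>Since Re w is half of w plus its conjugate, the transform of the weight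
        combines the induction hypothesis at the frequencies \<open>u *\<^sub>R k\<close>,
        \<open>u *\<^sub>R k + \<theta>\<close> and \<open>u *\<^sub>R k - \<theta>\<close>.\<close>
      have split: "complex_of_real (?I J A x * (1 + h z \<theta> x)) * iexp (u * (x \<bullet> k)) =
          1 * (complex_of_real (?I J A x) * iexp ((u *\<^sub>R k) \<bullet> x)) +
          z / 2 * (complex_of_real (?I J A x) * iexp ((u *\<^sub>R k + \<theta>) \<bullet> x)) +
          cnj z / 2 * (complex_of_real (?I J A x) * iexp ((u *\<^sub>R k - \<theta>) \<bullet> x))" for x
      proof -
        have "complex_of_real (h z \<theta> x) = (z * iexp (\<theta> \<bullet> x) + cnj z * iexp (- (\<theta> \<bullet> x))) / 2"
          unfolding h_def using complex_add_cnj[of "z * iexp (\<theta> \<bullet> x)"] by (simp add: exp_cnj)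
        moreover have "iexp ((u *\<^sub>R k + \<theta>) \<bullet> x) = iexp (u * (x \<bullet> k)) * iexp (\<theta> \<bullet> x)"
          "iexp ((u *\<^sub>R k - \<theta>) \<bullet> x) = iexp (u * (x \<bullet> k)) * iexp (- (\<theta> \<bullet> x))"
          "iexp ((u *\<^sub>R k) \<bullet> x) = iexp (u * (x \<bullet> k))"
          by (simp_all add: inner_add_left inner_diff_left exp_add[symmetric] algebra_simps inner_commute)
        ultimately show ?thesis
          by (simp only: of_real_mult of_real_add of_real_1) (simp add: algebra_simps)
      qed
      show "(CLINT x|M1. complex_of_real (?I J A x * (1 + h z \<theta> x)) * iexp (u * (x \<bullet> k))) =
            (CLINT x|M2. complex_of_real (?I J A x * (1 + h z \<theta> x)) * iexp (u * (x \<bullet> k)))"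
        unfolding split
        using int[OF assms(1,3), of 1] int[OF assms(2,4), of 1]
        by (simp only: mult_1 integral_lincomb3 IH)
    qed (use assms in auto)
    have two: "(LINT x|M1. ?I J A x * h z \<theta> x * indicator (A k) (x \<bullet> k)) =
               (LINT x|M2. ?I J A x * h z \<theta> x * indicator (A k) (x \<bullet> k))"
      if z: "cmod z \<le> 1" for z \<theta>
    proof -
      \<comment> \<open>At z = 0 the weight is the bare product of indicators; subtracting that
        instance removes the summand 1.\<close>
      have eq: "?I J A x * h z \<theta> x * indicator (A k) (x \<bullet> k) =
        ?I J A x * (1 + h z \<theta> x) * indicator (A k) (x \<bullet> k) -
        ?I J A x * (1 + h 0 \<theta> x) * indicator (A k) (x \<bullet> k)" for x
        by (simp add: h_def algebra_simps)
      have int': "integrable M (\<lambda>x. ?I J A x * (1 + h z \<theta> x) * indicator (A k) (x \<bullet> k))"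
        if "prob_space M" and [measurable_cong]: "sets M = sets borel" and z: "cmod z \<le> 1" for M z
      proof -
        interpret prob_space M by fact
        have "\<bar>?I J A x * (1 + h z \<theta> x) * indicator (A k) (x \<bullet> k)\<bar> \<le> (1 * 2) * 1" for x
          unfolding abs_mult using hb[OF z, of \<theta> x] I01[of A x J]
          by (intro mult_mono) (auto simp: indicator_def)
        then show ?thesis
          by (intro integrable_const_bound[where B=2]) auto
      qed
      show ?thesis
        unfolding eq by (simp add: int' assms z one)
    qed
    \<comment> \<open>Because Re (-i w) = Im w, the choices z = 1 and z = -i recover the real and
      the imaginary part.\<close>
    have fin: "(CLINT x|M. complex_of_real (?I (insert k J) A x) * iexp (\<theta> \<bullet> x)) =
       Complex (LINT x|M. ?I J A x * h 1 \<theta> x * indicator (A k) (x \<bullet> k))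
               (LINT x|M. ?I J A x * h (-\<i>) \<theta> x * indicator (A k) (x \<bullet> k))"
      if "prob_space M" and [measurable_cong]: "sets M = sets borel" for M
    proof -
      interpret prob_space M by fact
      have b: "cmod (complex_of_real (?I (insert k J) A x) * iexp (\<theta> \<bullet> x)) \<le> 1" for x
        using I01[of A x "insert k J"] by (simp add: norm_mult flip: of_real_prod)
      have i: "integrable M (\<lambda>x. complex_of_real (?I (insert k J) A x) * iexp (\<theta> \<bullet> x))"
        by (rule integrable_const_bound[where B=1]) (use b in auto)
      show ?thesis
        unfolding complex_eq_iff using insert.hyps i
        by (simp add: integral_Re[symmetric] integral_Im[symmetric] h_def mult_ac flip: of_real_prod)
    qed
    show ?case
      using two[of 1] two[of "-\<i>"] by (simp only: fin assms) (simp add: norm_mult)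
  qed
  have box: "emeasure M1 (box l u) = emeasure M2 (box l u)" for l u
  proof -
    have ind: "complex_of_real (?I Basis (\<lambda>b. {l\<bullet>b<..<u\<bullet>b}) x) * iexp (0 \<bullet> x) =
       complex_of_real (indicator (box l u) x)" for x
      by (auto simp: indicator_def box_def)
    have "complex_of_real (measure M1 (box l u)) = complex_of_real (measure M2 (box l u))"
      using key[of Basis "\<lambda>b. {l\<bullet>b<..<u\<bullet>b}" 0] assms unfolding ind
      by (simp add: sets_eq_imp_space_eq[OF assms(3)] sets_eq_imp_space_eq[OF assms(4)])
    then show ?thesis
      by (simp add: M1.emeasure_eq_measure M2.emeasure_eq_measure)
  qed
  show ?thesis
  proof (rule measure_eqI_generator_eq)
    let ?E = "range (\<lambda>(a, b). box a b::'a set)"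
    show "Int_stable ?E"
      by (auto simp: Int_stable_def box_Int_box)
    show "?E \<subseteq> Pow UNIV" "sets M1 = sigma_sets UNIV ?E" "sets M2 = sigma_sets UNIV ?E"
      by (simp_all add: assms borel_eq_box)
    let ?A = "\<lambda>n::nat. box (- (real n *\<^sub>R One)) (real n *\<^sub>R One) :: 'a set"
    show "range ?A \<subseteq> ?E" "(\<Union>i. ?A i) = UNIV"
      unfolding UN_box_eq_UNIV by auto
    show "emeasure M1 (?A i) \<noteq> \<infinity>" for i by simp
    show "emeasure M1 X = emeasure M2 X" if "X \<in> ?E" for X
      using that box by auto
  qed
qed

section \<open>Factorisation of positive semidefinite matrices\<close>

lemma positive_semidefinite_symmetric:
  assumes "positive_semidefinite S"
  shows "S $ i $ j = S $ j $ i" "x \<bullet> (S *v y) = y \<bullet> (S *v x)"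
proof -
  have T: "transpose S = S" using assms by (simp add: positive_semidefinite_def)
  show "S $ i $ j = S $ j $ i"
    using arg_cong[OF T, of "\<lambda>M. M $ i $ j"] by (simp add: transpose_def)
  show "x \<bullet> (S *v y) = y \<bullet> (S *v x)"
    by (metis T dot_lmul_matrix inner_commute vector_transpose_matrix)
qed

lemma inner_axis_matrix:
  fixes S :: "real ^ 'n ^ 'n"
  shows "axis k 1 \<bullet> (S *v x) = S $ k \<bullet> x"
  by (simp add: inner_axis' matrix_vector_mul_component)

lemma positive_semidefinite_zero_row:
  fixes S :: "real ^ 'n ^ 'n"
  assumes S: "positive_semidefinite S" and k: "S $ k $ k = 0"
  shows "S $ k $ j = 0"
proof (rule ccontr)
  assume nz: "S $ k $ j \<noteq> 0"
  \<comment> \<open>With \<open>S $ k $ k = 0\<close> the quadratic form at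
    \<open>r *\<^sub>R axis k 1 + axis j 1\<close> is affine in r with slope
    \<open>2 * S $ k $ j\<close>; this r gives it the value -1.\<close>
  define r where "r = - (S $ j $ j + 1) / (2 * S $ k $ j)"
  let ?x = "r *\<^sub>R axis k 1 + axis j (1::real)"
  have "0 \<le> ?x \<bullet> (S *v ?x)"
    using S by (simp add: positive_semidefinite_def)
  also have "\<dots> = r * r * S $ k $ k + r * S $ k $ j + r * S $ j $ k + S $ j $ j"
    by (simp add: inner_add_left inner_add_right matrix_vector_right_distrib
        matrix_vector_mult_scaleR inner_axis_matrix inner_axis algebra_simps)
  also have "\<dots> = 2 * r * S $ k $ j + S $ j $ j"
    using k positive_semidefinite_symmetric(1)[OF S, of j k] by simp
  also have "\<dots> = -1"
    using nz by (simp add: r_def field_simps)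
  finally show False by simp
qed

text \<open>Completing the square: the form of the complement at x is the form of S at
  \<open>x - c *\<^sub>R axis k 1\<close>, where c minimises it along that line.\<close>

lemma positive_semidefinite_schur_complement:
  fixes S :: "real ^ 'n ^ 'n"
  assumes S: "positive_semidefinite S" and k: "S $ k $ k > 0"
  shows "positive_semidefinite (\<chi> i j. S $ i $ j - S $ k $ i * S $ k $ j / S $ k $ k)"
    (is "positive_semidefinite ?T")
  unfolding positive_semidefinite_def
proof (intro conjI allI)
  show "transpose ?T = ?T"
    using positive_semidefinite_symmetric(1)[OF S] by (simp add: transpose_def vec_eq_iff)
next
  fix x :: "real ^ 'n"
  define c where "c = (S $ k \<bullet> x) / S $ k $ k"
  let ?y = "x - c *\<^sub>R axis k 1"
  have "x \<bullet> (S *v axis k 1) = S $ k \<bullet> x"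
    using positive_semidefinite_symmetric(2)[OF S, of x "axis k 1"] by (simp add: inner_axis_matrix)
  then have y: "?y \<bullet> (S *v ?y) = x \<bullet> (S *v x) - (S $ k \<bullet> x)\<^sup>2 / S $ k $ k"
    using k by (simp add: inner_diff_left inner_diff_right matrix_vector_mult_diff_distrib
        matrix_vector_mult_scaleR inner_axis_matrix inner_axis algebra_simps c_def power2_eq_square)
  have T: "?T *v x = S *v x - ((S $ k \<bullet> x) / S $ k $ k) *\<^sub>R S $ k"
    by (simp add: vec_eq_iff matrix_vector_mult_def inner_vec_def algebra_simps sum_subtractf
        sum_distrib_left sum_divide_distrib)
  have "x \<bullet> (?T *v x) = ?y \<bullet> (S *v ?y)"
    unfolding T y by (simp add: inner_diff_right inner_commute power2_eq_square)
  then show "0 \<le> x \<bullet> (?T *v x)"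
    using S by (simp add: positive_semidefinite_def)
qed

text \<open>Cholesky elimination, by induction on the number of nonzero diagonal entries. The clause
  that \<open>v k\<close> vanishes when \<open>S $ k $ k = 0\<close> strengthens the induction: it
  keeps one slot per index, so that the vectors become the columns of a square factor.\<close>

lemma positive_semidefinite_sum_rank_one:
  fixes S :: "real ^ 'n ^ 'n"
  assumes "positive_semidefinite S"
  shows "\<exists>v :: 'n \<Rightarrow> real ^ 'n. (\<forall>k. S $ k $ k = 0 \<longrightarrow> v k = 0) \<and>
           (\<forall>i j. S $ i $ j = (\<Sum>k\<in>UNIV. v k $ i * v k $ j))"
  using assms
proof (induction "card {k. S $ k $ k \<noteq> 0}" arbitrary: S rule: less_induct)
  case less
  have diag: "0 \<le> S $ k $ k" for k
    using less.prems by (metis inner_axis_matrix positive_semidefinite_def inner_axis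
        inner_commute inner_real_def mult_1)
  show ?case
  proof (cases "\<exists>k. S $ k $ k \<noteq> 0")
    case False
    then have "S $ i $ j = 0" for i j
      using positive_semidefinite_zero_row[OF less.prems] by blast
    then show ?thesis by (intro exI[of _ "\<lambda>_. 0"]) simp
  next
    case True
    then obtain k where "S $ k $ k \<noteq> 0" by blast
    with diag[of k] have k: "S $ k $ k > 0" by simp
    define T :: "real ^ 'n ^ 'n" where "T = (\<chi> i j. S $ i $ j - S $ k $ i * S $ k $ j / S $ k $ k)"
    have T: "positive_semidefinite T"
      unfolding T_def by (rule positive_semidefinite_schur_complement[OF less.prems k])
    have Tk: "T $ k $ k = 0" using k by (simp add: T_def)
    \<comment> \<open>A zero diagonal entry forces a zero row, so elimination creates no new nonzero
      diagonal entry; as entry k disappears, the count drops.\<close>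
    have Tz: "T $ i $ i = 0" if "S $ i $ i = 0" for i
      using positive_semidefinite_zero_row[OF less.prems that, of k] that
        positive_semidefinite_symmetric(1)[OF less.prems, of i k] by (simp add: T_def)
    have "{i. T $ i $ i \<noteq> 0} \<subset> {i. S $ i $ i \<noteq> 0}"
      using Tz Tk k by fastforce
    then have "card {i. T $ i $ i \<noteq> 0} < card {i. S $ i $ i \<noteq> 0}"
      by (intro psubset_card_mono) auto
    from less.hyps[OF this T] obtain v :: "'n \<Rightarrow> real ^ 'n" where
      v0: "\<And>i. T $ i $ i = 0 \<Longrightarrow> v i = 0" and
      v: "\<And>i j. T $ i $ j = (\<Sum>k\<in>UNIV. v k $ i * v k $ j)"
      by blast
    \<comment> \<open>Slot k is free: \<open>T $ k $ k = 0\<close> makes \<open>v k = 0\<close>, so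
      the eliminated rank-one term can be stored there.\<close>
    define w where "w = v (k := (1 / sqrt (S $ k $ k)) *\<^sub>R S $ k)"
    show ?thesis
    proof (intro exI[of _ w] conjI allI impI)
      fix i assume "S $ i $ i = 0"
      then show "w i = 0" using k v0 Tz by (auto simp: w_def)
    next
      fix i j
      have "(\<Sum>l\<in>UNIV. w l $ i * w l $ j) = w k $ i * w k $ j + (\<Sum>l\<in>UNIV - {k}. w l $ i * w l $ j)"
        by (subst sum.remove[of _ k]) auto
      also have "w k $ i * w k $ j = S $ k $ i * S $ k $ j / S $ k $ k"
        using k by (simp add: w_def field_simps)
      also have "(\<Sum>l\<in>UNIV - {k}. w l $ i * w l $ j) = (\<Sum>l\<in>UNIV - {k}. v l $ i * v l $ j)"
        by (intro sum.cong) (auto simp: w_def)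
      also have "\<dots> = (\<Sum>l\<in>UNIV. v l $ i * v l $ j)"
        using v0[OF Tk] by (subst (2) sum.remove[of _ k]) auto
      also have "\<dots> = T $ i $ j" by (simp add: v)
      finally show "S $ i $ j = (\<Sum>l\<in>UNIV. w l $ i * w l $ j)"
        by (simp add: T_def)
    qed
  qed
qed

lemma positive_semidefinite_factor:
  fixes S :: "real ^ 'n ^ 'n"
  assumes "positive_semidefinite S"
  shows "\<exists>A :: real ^ 'n ^ 'n. S = A ** transpose A"
proof -
  obtain v :: "'n \<Rightarrow> real ^ 'n" where v: "\<And>i j. S $ i $ j = (\<Sum>k\<in>UNIV. v k $ i * v k $ j)"
    using positive_semidefinite_sum_rank_one[OF assms] by blast
  show ?thesis
    by (rule exI[of _ "\<chi> i k. v k $ i"]) (simp add: vec_eq_iff matrix_matrix_mult_def transpose_def v)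
qed

section \<open>The standard Gaussian measure and its polar decomposition\<close>

text \<open>Written as a product over the basis, so that total mass and characteristic function
  factor into one-dimensional integrals; \<open>std_gaussian_density\<close> supplies the radial
  form on which the polar decomposition rests.\<close>

definition std_gaussian :: "'a::euclidean_space measure" where
  "std_gaussian = density lborel (\<lambda>x. ennreal (\<Prod>b\<in>Basis. std_normal_density (x \<bullet> b)))"

lemma sets_std_gaussian[simp, measurable_cong]: "sets std_gaussian = sets borel"
  and space_std_gaussian[simp]: "space std_gaussian = UNIV"
  by (simp_all add: std_gaussian_def)

lemma prob_space_std_gaussian: "prob_space (std_gaussian :: 'a::euclidean_space measure)"
proof
  interpret N: prob_space std_normal_distribution by (rule prob_space_normal_density) simp
  have "(\<integral>\<^sup>+x. ennreal (std_normal_density x) \<partial>lborel) = 1"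
    using N.emeasure_space_1 by (simp add: emeasure_density)
  then show "emeasure (std_gaussian :: 'a measure) (space std_gaussian) = 1"
    by (simp add: std_gaussian_def emeasure_density prod_ennreal[symmetric]
        nn_integral_lborel_prod[where f="\<lambda>_ x. ennreal (std_normal_density x)"])
qed

lemma sum_Basis_inner_square: "(\<Sum>b\<in>Basis. (x \<bullet> b)\<^sup>2) = (norm x)\<^sup>2"
  by (simp only: power2_norm_eq_inner euclidean_inner[of x x]) (simp only: power2_eq_square)

lemma std_gaussian_density:
  fixes x :: "'a::euclidean_space"
  shows "(\<Prod>b\<in>Basis. std_normal_density (x \<bullet> b)) =
    (2 * pi) powr (- (real DIM('a) / 2)) * exp (- (norm x)\<^sup>2 / 2)"
proof -
  have "(\<Prod>b\<in>Basis. std_normal_density (x \<bullet> b)) =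
      (1 / sqrt (2 * pi)) ^ DIM('a) * exp (- (\<Sum>b\<in>Basis. (x \<bullet> b)\<^sup>2) / 2)"
    by (simp add: std_normal_density_def prod.distrib exp_sum[symmetric] sum_negf sum_divide_distrib
        power_divide prod_dividef)
  also have "(\<Sum>b\<in>Basis. (x \<bullet> b)\<^sup>2) = (norm x)\<^sup>2"
    by (rule sum_Basis_inner_square)
  also have "(1 / sqrt (2 * pi)) ^ DIM('a) = (2 * pi) powr (- (real DIM('a) / 2))"
    by (simp add: powr_half_sqrt[symmetric] powr_power powr_minus_divide power_one_over)
  finally show ?thesis .
qed

text \<open>Lebesgue measure is the image of a product of line measures under the coordinate map, so
  the integral splits into the characteristic functions of one-dimensional standard normals.\<close>

lemma char_std_gaussian:
  fixes \<theta> :: "'a::euclidean_space"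
  shows "(CLINT x|std_gaussian. iexp (\<theta> \<bullet> x)) = complex_of_real (exp (- (norm \<theta>)\<^sup>2 / 2))"
proof -
  interpret product_sigma_finite "\<lambda>_::'a. lborel :: real measure" ..
  let ?f = "\<lambda>b x. complex_of_real (std_normal_density x) * iexp ((\<theta> \<bullet> b) * x)"
  have f: "integrable lborel (?f b)" "integral\<^sup>L lborel (?f b) = exp (- (\<theta> \<bullet> b)\<^sup>2 / 2)" for b
  proof -
    interpret N: prob_space std_normal_distribution by (rule prob_space_normal_density) simp
    have "integrable std_normal_distribution (\<lambda>x. iexp ((\<theta> \<bullet> b) * x))"
      by (rule N.integrable_const_bound[where B=1]) auto
    then show "integrable lborel (?f b)"
      by (subst (asm) integrable_density) (auto simp: scaleR_conv_of_real)
    show "integral\<^sup>L lborel (?f b) = exp (- (\<theta> \<bullet> b)\<^sup>2 / 2)"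
      using fun_cong[OF char_std_normal_distribution, of "\<theta> \<bullet> b"]
      unfolding char_def by (subst (asm) integral_density) (auto simp: scaleR_conv_of_real)
  qed
  have iexp: "iexp (\<theta> \<bullet> x) = (\<Prod>b\<in>Basis. iexp ((\<theta> \<bullet> b) * (x \<bullet> b)))" for x
    by (subst euclidean_inner[of \<theta> x]) (simp add: exp_sum[symmetric] sum_distrib_left)
  have "(CLINT x|std_gaussian. iexp (\<theta> \<bullet> x)) =
        (CLINT x|lborel. (\<Prod>b\<in>Basis. std_normal_density (x \<bullet> b)) *\<^sub>R iexp (\<theta> \<bullet> x))"
    unfolding std_gaussian_def by (subst integral_density) (auto intro!: prod_nonneg)
  also have "\<dots> = (CLINT x|lborel. (\<Prod>b\<in>Basis. ?f b (x \<bullet> b)))"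
    by (simp only: iexp prod.distrib scaleR_conv_of_real of_real_prod)
  also have "\<dots> = (\<integral>g. (\<Prod>b\<in>Basis. ?f b ((\<Sum>b\<in>Basis. g b *\<^sub>R b :: 'a) \<bullet> b)) \<partial>(\<Pi>\<^sub>M b\<in>Basis. lborel))"
    by (subst lborel_eq, subst integral_distr) auto
  also have "\<dots> = (\<integral>g. (\<Prod>b\<in>Basis. ?f b (g b)) \<partial>(\<Pi>\<^sub>M b\<in>Basis. lborel))"
    by (intro Bochner_Integration.integral_cong prod.cong refl)
       (simp add: inner_sum_left inner_Basis if_distrib sum.delta' cong: if_cong)
  also have "\<dots> = (\<Prod>b\<in>Basis. complex_of_real (exp (- (\<theta> \<bullet> b)\<^sup>2 / 2)))"
    by (subst product_integral_prod) (auto simp only: f finite_Basis)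
  also have "\<dots> = complex_of_real (exp (- (\<Sum>b\<in>Basis. (\<theta> \<bullet> b)\<^sup>2) / 2))"
    by (simp add: exp_sum[symmetric] sum_negf sum_divide_distrib of_real_prod[symmetric] del: of_real_prod)
  also have "(\<Sum>b\<in>Basis. (\<theta> \<bullet> b)\<^sup>2) = (norm \<theta>)\<^sup>2"
    by (rule sum_Basis_inner_square)
  finally show ?thesis .
qed

section \<open>Polar factorisation of Lebesgue and Gaussian measure\<close>

lemma emeasure_lborel_cone:
  fixes D :: "'a::euclidean_space set"
  assumes [measurable]: "D \<in> sets borel"
  shows "emeasure lborel ({x. x /\<^sub>R norm x \<in> D} \<inter> {x. norm x < r}) * emeasure lborel (ball (0::'a) 1) =
    emeasure lborel ({x. x /\<^sub>R norm x \<in> D} \<inter> ball 0 1) * emeasure lborel {x::'a. norm x < r}"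
proof (cases "r > 0")
  case False
  then have "{x::'a. norm x < r} = {}"
    using norm_ge_zero order_le_less_trans by blast
  then show ?thesis by simp
next
  case r: True
  let ?C = "\<lambda>D. {x::'a. x /\<^sub>R norm x \<in> D}"
  \<comment> \<open>Dilation by r preserves the cone over D and multiplies volumes by the same power
    of r for every D; comparing D with \<open>UNIV\<close> in cross-multiplied form avoids dividing
    extended reals.\<close>
  have main: "emeasure lborel (?C D \<inter> {x. norm x < r}) = ennreal (r ^ DIM('a)) * emeasure lborel (?C D \<inter> ball 0 1)"
    if [measurable]: "D \<in> sets borel" for D
  proof -
    have scale: "(inverse r * inverse (norm x) * r) *\<^sub>R x = x /\<^sub>R norm x" for x :: 'a
      using r by simp
    have "emeasure lborel (?C D \<inter> {x. norm x < r}) =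
      emeasure (density (distr lborel borel (\<lambda>x. 0 + r *\<^sub>R x)) (\<lambda>_. \<bar>r\<bar> ^ DIM('a))) (?C D \<inter> {x. norm x < r})"
      using r by (subst lborel_affine[of r 0]) auto
    also have "\<dots> = ennreal (r ^ DIM('a)) *
        emeasure lborel ((\<lambda>x. r *\<^sub>R x) -` (?C D \<inter> {x. norm x < r}))"
      using r by (simp add: emeasure_density nn_integral_cmult_indicator emeasure_distr)
    also have "(\<lambda>x. r *\<^sub>R x) -` (?C D \<inter> {x. norm x < r}) = ?C D \<inter> ball 0 1"
      using r by (auto simp: scale)
    finally show ?thesis .
  qed
  have "?C UNIV = UNIV" by simp
  then show ?thesis
    using main[of D] main[of UNIV] by (simp add: mult_ac)
qed

text \<open>Cones meet the balls around the origin in proportion to the volume of the balls, so the norm and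
  the direction of Lebesgue measure factor.\<close>

lemma nn_integral_lborel_cone:
  fixes D :: "'a::euclidean_space set" and h :: "real \<Rightarrow> ennreal"
  assumes [measurable]: "D \<in> sets borel" "h \<in> borel_measurable borel"
  defines "s \<equiv> emeasure lborel ({x. x /\<^sub>R norm x \<in> D} \<inter> ball 0 1) / emeasure lborel (ball (0::'a) 1)"
  shows "(\<integral>\<^sup>+x. indicator {x. x /\<^sub>R norm x \<in> D} x * h (norm x) \<partial>lborel) = s * (\<integral>\<^sup>+x. h (norm x) \<partial>(lborel :: 'a measure))"
proof -
  let ?C = "{x::'a. x /\<^sub>R norm x \<in> D}"
  let ?b = "emeasure lborel (ball (0::'a) 1)"
  have b: "?b \<noteq> 0" "?b \<noteq> \<infinity>"
  proof -
    show "?b \<noteq> \<infinity>"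
      using emeasure_lborel_ball_finite[of "0::'a" 1] by simp
    show "?b \<noteq> 0"
      using open_not_negligible[of "ball (0::'a) 1"] by (auto simp: negligible_iff_null_sets null_sets_def)
  qed
  \<comment> \<open>Both are measures on the line: the law of the norm under Lebesgue measure
    restricted to the cone, and s times the law of the norm under all of Lebesgue measure. Balls
    centred at 0 correspond to half-lines, which generate the Borel sets.\<close>
  define K1 where "K1 = distr (density lborel (indicator ?C)) borel (norm :: 'a \<Rightarrow> real)"
  define K2 where "K2 = density (distr lborel borel (norm :: 'a \<Rightarrow> real)) (\<lambda>_. s)"
  have e1: "emeasure K1 {..<r} = emeasure lborel (?C \<inter> {x. norm x < r})" for r
  proof -
    have [measurable]: "(norm :: 'a \<Rightarrow> real) -` {..<r} \<in> sets borel"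
      using measurable_sets[of "norm :: 'a \<Rightarrow> real" borel borel "{..<r}"] by simp
    have "emeasure K1 {..<r} = (\<integral>\<^sup>+x. indicator ?C x * indicator (norm -` {..<r}) x \<partial>lborel)"
      unfolding K1_def by (simp add: emeasure_distr emeasure_density)
    also have "\<dots> = (\<integral>\<^sup>+x. indicator (?C \<inter> {x. norm x < r}) x \<partial>lborel)"
      by (intro nn_integral_cong) (auto simp: indicator_def)
    finally show ?thesis by simp
  qed
  have e2: "emeasure K2 {..<r} = s * emeasure lborel {x::'a. norm x < r}" for r
    unfolding K2_def by (auto simp: emeasure_density emeasure_distr nn_integral_cmult_indicator vimage_def)
  have eq: "emeasure K1 {..<r} = emeasure K2 {..<r}" for r
  proof -
    have "emeasure K1 {..<r} = emeasure K1 {..<r} * ?b / ?b"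
      using b by (simp add: ennreal_mult_divide_eq)
    also have "\<dots> = emeasure K2 {..<r}"
      unfolding e1 e2 emeasure_lborel_cone[OF assms(1)]
      by (simp add: s_def divide_ennreal_def mult_ac)
    finally show ?thesis .
  qed
  have "K1 = K2"
  proof (rule measure_eqI_generator_eq)
    let ?E = "range (\<lambda>r::real. {..<r})"
    have "{..<a} \<inter> {..<b} = {..<min a b}" for a b :: real by auto
    then show "Int_stable ?E" by (auto simp: Int_stable_def)
    show "?E \<subseteq> Pow UNIV" "sets K1 = sigma_sets UNIV ?E" "sets K2 = sigma_sets UNIV ?E"
      by (simp_all add: K1_def K2_def borel_Iio)
    show "range (\<lambda>n::nat. {..<real n}) \<subseteq> ?E" "(\<Union>n::nat. {..<real n}) = UNIV"
      by (auto intro: reals_Archimedean2)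
    show "emeasure K1 {..<real n} \<noteq> \<infinity>" for n
    proof -
      have "emeasure K1 {..<real n} \<le> emeasure lborel (ball (0::'a) (real n))"
        unfolding e1 by (rule emeasure_mono) auto
      also have "\<dots> < \<infinity>" by (rule emeasure_lborel_ball_finite)
      finally show ?thesis by simp
    qed
    show "emeasure K1 X = emeasure K2 X" if "X \<in> ?E" for X
      using that eq by auto
  qed
  have "(\<integral>\<^sup>+x. indicator ?C x * h (norm x) \<partial>lborel) = (\<integral>\<^sup>+r. h r \<partial>K1)"
    unfolding K1_def by (simp add: nn_integral_distr nn_integral_density)
  also have "\<dots> = s * (\<integral>\<^sup>+x. h (norm x) \<partial>(lborel :: 'a measure))"
    unfolding \<open>K1 = K2\<close> K2_def by (simp add: nn_integral_distr nn_integral_density nn_integral_cmult)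
  finally show ?thesis .
qed

lemma emeasure_uniform_sphere:
  assumes [measurable]: "D \<in> sets borel"
  shows "emeasure (uniform_sphere :: (real ^ 'n) measure) D =
    emeasure lborel ({x. x /\<^sub>R norm x \<in> D} \<inter> ball 0 1) / emeasure lborel (ball (0 :: real ^ 'n) 1)"
  unfolding uniform_sphere_def
  by (subst emeasure_distr) (auto simp: vimage_def Int_commute)

text \<open>The Gaussian density is a function of the norm alone, so together with the indicator of
  A it can serve as the radial integrand \<open>h\<close> of the cone formula.\<close>

lemma std_gaussian_polar:
  fixes D :: "(real ^ 'n) set"
  assumes [measurable]: "A \<in> sets borel" "D \<in> sets borel"
  shows "emeasure std_gaussian {x::real^'n. norm x \<in> A \<and> x /\<^sub>R norm x \<in> D} =
    emeasure std_gaussian {x::real^'n. norm x \<in> A} * emeasure uniform_sphere D"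
proof -
  define p where "p r = ennreal ((2 * pi) powr (- (real CARD('n) / 2)) * exp (- r\<^sup>2 / 2))" for r
  have [measurable]: "p \<in> borel_measurable borel" unfolding p_def by measurable
  have dens: "(std_gaussian :: (real^'n) measure) = density lborel (\<lambda>x. p (norm x))"
    unfolding std_gaussian_def std_gaussian_density by (simp add: p_def)
  have "emeasure std_gaussian {x::real^'n. norm x \<in> A \<and> x /\<^sub>R norm x \<in> D} =
    (\<integral>\<^sup>+x. indicator {x. x /\<^sub>R norm x \<in> D} x * (p (norm x) * indicator A (norm x)) \<partial>(lborel :: (real^'n) measure))"
    unfolding dens by (subst emeasure_density) (auto intro!: nn_integral_cong simp: indicator_def)
  also have "\<dots> = emeasure uniform_sphere D * (\<integral>\<^sup>+x. p (norm x) * indicator A (norm x) \<partial>(lborel :: (real^'n) measure))"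
    by (subst nn_integral_lborel_cone) (simp_all add: emeasure_uniform_sphere)
  also have "(\<integral>\<^sup>+x. p (norm x) * indicator A (norm x) \<partial>(lborel :: (real^'n) measure)) =
     emeasure std_gaussian {x::real^'n. norm x \<in> A}"
    unfolding dens by (subst emeasure_density) (auto intro!: nn_integral_cong simp: indicator_def)
  finally show ?thesis by (simp add: mult.commute)
qed

section \<open>Gaussian scale mixtures\<close>

definition gaussian_mixture :: "real measure \<Rightarrow> 'a::euclidean_space measure" where
  "gaussian_mixture L = distr (L \<Otimes>\<^sub>M std_gaussian) borel (\<lambda>(y, z). sqrt y *\<^sub>R z)"

lemma sets_gaussian_mixture[simp, measurable_cong]: "sets (gaussian_mixture L) = sets borel"
  and space_gaussian_mixture[simp]: "space (gaussian_mixture L) = UNIV"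
  by (simp_all add: gaussian_mixture_def)

lemma borel_measurable_matrix_vector_mult[measurable (raw)]:
  fixes A :: "real ^ 'n ^ 'm"
  assumes "f \<in> borel_measurable M"
  shows "(\<lambda>x. A *v f x) \<in> borel_measurable M"
  using assms by (rule borel_measurable_continuous_on[rotated]) (rule matrix_vector_mult_linear_continuous_on)

text \<open>Everything later required of the M-Wright law: a probability on the positive half-line
  with known Laplace transform. The point mass and the laws with a density are both
  instances.\<close>

locale mixing_law = prob_space L for L :: "real measure" +
  fixes \<phi> :: "real \<Rightarrow> real"
  assumes sets_L[measurable_cong]: "sets L = sets borel"
    and pos: "AE y in L. 0 < y"
    and laplace: "0 \<le> s \<Longrightarrow> (LINT y|L. exp (- (s * y))) = \<phi> s"
begin

sublocale LG: pair_prob_space L "std_gaussian :: 'a::euclidean_space measure"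
  by (intro pair_prob_space.intro pair_sigma_finite.intro prob_space_std_gaussian
      prob_space_imp_sigma_finite prob_space_axioms)

lemma prob_space_gaussian_mixture: "prob_space (gaussian_mixture L :: 'a::euclidean_space measure)"
  unfolding gaussian_mixture_def by (rule LG.prob_space_distr) measurable

lemma nn_integral_gaussian_mixture:
  assumes [measurable]: "f \<in> borel_measurable borel"
  shows "(\<integral>\<^sup>+x. f x \<partial>gaussian_mixture L) = (\<integral>\<^sup>+y. \<integral>\<^sup>+z. f (sqrt y *\<^sub>R z) \<partial>std_gaussian \<partial>L)"
  unfolding gaussian_mixture_def
  by (simp add: nn_integral_distr LG.M2.nn_integral_fst[symmetric] split_beta')

lemma char_gaussian_mixture:
  fixes \<theta> :: "'a::euclidean_space"
  shows "(CLINT x|gaussian_mixture L. iexp (\<theta> \<bullet> x)) = complex_of_real (\<phi> ((norm \<theta>)\<^sup>2 / 2))"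
proof -
  have "(CLINT x|gaussian_mixture L. iexp (\<theta> \<bullet> x)) =
    (CLINT p|L \<Otimes>\<^sub>M std_gaussian. iexp (\<theta> \<bullet> (sqrt (fst p) *\<^sub>R snd p)))"
    unfolding gaussian_mixture_def by (subst integral_distr) (auto simp: split_beta')
  also have "\<dots> = (CLINT y|L. CLINT z|std_gaussian. iexp (\<theta> \<bullet> (sqrt y *\<^sub>R z)))"
    by (subst LG.integral_fst'[symmetric]) (auto intro!: LG.P.integrable_const_bound[where B=1])
  also have "\<dots> = (CLINT y|L. complex_of_real (exp (- ((norm \<theta>)\<^sup>2 / 2 * y))))"
  proof (rule integral_cong_AE)
    have "(CLINT z|std_gaussian. iexp (\<theta> \<bullet> (sqrt y *\<^sub>R z))) = complex_of_real (exp (- ((norm \<theta>)\<^sup>2 / 2 * y)))"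
      if "0 < y" for y
    proof -
      have "(CLINT z|std_gaussian. iexp (\<theta> \<bullet> (sqrt y *\<^sub>R z))) = (CLINT z|std_gaussian. iexp ((sqrt y *\<^sub>R \<theta>) \<bullet> z))"
        by simp
      also have "\<dots> = complex_of_real (exp (- (norm (sqrt y *\<^sub>R \<theta>))\<^sup>2 / 2))"
        by (rule char_std_gaussian)
      finally show ?thesis using that by (simp add: power_mult_distrib mult.commute)
    qed
    then show "AE y in L. (CLINT z|std_gaussian. iexp (\<theta> \<bullet> (sqrt y *\<^sub>R z))) =
        complex_of_real (exp (- ((norm \<theta>)\<^sup>2 / 2 * y)))"
      using pos by auto
  qed measurable
  also have "\<dots> = complex_of_real (\<phi> ((norm \<theta>)\<^sup>2 / 2))"
    by (subst laplace[symmetric], simp, rule integral_complex_of_real)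
  finally show ?thesis .
qed

text \<open>Moving A to the other side of the inner product turns the norm of
  \<open>transpose A *v \<theta>\<close> into the quadratic form of
  \<open>A ** transpose A\<close>.\<close>

lemma char_linear_gaussian_mixture:
  fixes A :: "real ^ 'n ^ 'm"
  shows "(CLINT x|distr (gaussian_mixture L) borel ((*v) A). iexp (\<theta> \<bullet> x)) =
    complex_of_real (\<phi> (\<theta> \<bullet> ((A ** transpose A) *v \<theta>) / 2))"
proof -
  have "(CLINT x|distr (gaussian_mixture L) borel ((*v) A). iexp (\<theta> \<bullet> x)) =
     (CLINT x|gaussian_mixture L. iexp ((transpose A *v \<theta>) \<bullet> x))"
    by (subst integral_distr) (auto simp: dot_lmul_matrix[symmetric] transpose_matrix_vector)
  also have "\<dots> = complex_of_real (\<phi> ((norm (transpose A *v \<theta>))\<^sup>2 / 2))"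
    by (rule char_gaussian_mixture)
  also have "(norm (transpose A *v \<theta>))\<^sup>2 = \<theta> \<bullet> ((A ** transpose A) *v \<theta>)"
    by (simp add: power2_norm_eq_inner matrix_vector_mul_assoc[symmetric] dot_lmul_matrix[symmetric]
        transpose_matrix_vector)
  finally show ?thesis .
qed

text \<open>The characteristic function sees A only through \<open>A ** transpose A\<close>, so
  every factor of the covariance matrix, singular or not, represents the same law.\<close>

lemma eq_linear_gaussian_mixture:
  fixes A :: "real ^ 'n ^ 'm"
  assumes "prob_space M" "sets M = sets borel"
    and "\<And>\<theta>. (CLINT x|M. iexp (\<theta> \<bullet> x)) = complex_of_real (\<phi> (\<theta> \<bullet> ((A ** transpose A) *v \<theta>) / 2))"
  shows "M = distr (gaussian_mixture L) borel ((*v) A)"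
proof (rule char_euclidean_unique)
  show "prob_space (distr (gaussian_mixture L) borel ((*v) A))"
    by (rule prob_space.prob_space_distr[OF prob_space_gaussian_mixture]) measurable
qed (simp_all only: assms char_linear_gaussian_mixture sets_distr)

lemma characteristic_generator_mixture: "characteristic_generator TYPE('n::finite) \<phi>"
  unfolding characteristic_generator_def
proof (intro exI conjI allI)
  \<comment> \<open>The factor \<open>sqrt 2\<close> reconciles two conventions: the mixture has
    characteristic function \<phi> at half the squared norm, a generator is evaluated at the squared
    norm.\<close>
  let ?\<nu> = "distr (gaussian_mixture L) borel (\<lambda>x :: real ^ 'n. sqrt 2 *\<^sub>R x)"
  show "prob_space ?\<nu>"
    by (rule prob_space.prob_space_distr[OF prob_space_gaussian_mixture]) measurable
  show "sets ?\<nu> = sets borel" by simp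
  fix \<theta> :: "real ^ 'n"
  have "(CLINT x|?\<nu>. iexp (\<theta> \<bullet> x)) = (CLINT x|gaussian_mixture L. iexp ((sqrt 2 *\<^sub>R \<theta>) \<bullet> x))"
    by (subst integral_distr) auto
  also have "\<dots> = complex_of_real (\<phi> ((norm (sqrt 2 *\<^sub>R \<theta>))\<^sup>2 / 2))"
    by (rule char_gaussian_mixture)
  finally show "(CLINT x|?\<nu>. iexp (\<theta> \<bullet> x)) = complex_of_real (\<phi> (\<theta> \<bullet> \<theta>))"
    by (simp add: power_mult_distrib power2_norm_eq_inner)
qed

text \<open>For each y > 0, scaling by \<open>sqrt y\<close> changes the norm but not the direction,
  so the Gaussian factorisation holds conditionally with a directional factor independent of y,
  which leaves the integral over L.\<close>

lemma gaussian_mixture_polar: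
  fixes D :: "(real ^ 'n) set"
  assumes [measurable]: "A \<in> sets borel" "D \<in> sets borel"
  shows "emeasure (gaussian_mixture L) {x::real^'n. norm x \<in> A \<and> x /\<^sub>R norm x \<in> D} =
    emeasure (gaussian_mixture L) {x::real^'n. norm x \<in> A} * emeasure uniform_sphere D"
proof -
  have int: "emeasure (gaussian_mixture L) E = (\<integral>\<^sup>+y. emeasure std_gaussian ((\<lambda>z. sqrt y *\<^sub>R z) -` E) \<partial>L)"
    if [measurable]: "E \<in> sets borel" for E :: "(real^'n) set"
  proof -
    have "emeasure (gaussian_mixture L) E = (\<integral>\<^sup>+x. indicator E x \<partial>gaussian_mixture L)" by simp
    also have "\<dots> = (\<integral>\<^sup>+y. \<integral>\<^sup>+z. indicator E (sqrt y *\<^sub>R z) \<partial>std_gaussian \<partial>L)"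
      by (rule nn_integral_gaussian_mixture) simp
    also have "\<dots> = (\<integral>\<^sup>+y. \<integral>\<^sup>+z. indicator ((\<lambda>z. sqrt y *\<^sub>R z) -` E) z \<partial>std_gaussian \<partial>L)"
      by (simp add: indicator_def)
    also have "\<dots> = (\<integral>\<^sup>+y. emeasure std_gaussian ((\<lambda>z. sqrt y *\<^sub>R z) -` E) \<partial>L)"
    proof (intro nn_integral_cong nn_integral_indicator)
      fix y
      have "(\<lambda>z::real^'n. sqrt y *\<^sub>R z) \<in> borel_measurable borel" by measurable
      from measurable_sets[OF this that]
      show "(\<lambda>z. sqrt y *\<^sub>R z) -` E \<in> sets std_gaussian" by simp
    qed
    finally show ?thesis .
  qed
  have "emeasure (gaussian_mixture L) {x::real^'n. norm x \<in> A \<and> x /\<^sub>R norm x \<in> D} =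
    (\<integral>\<^sup>+y. emeasure std_gaussian ((\<lambda>z. sqrt y *\<^sub>R z) -` {x::real^'n. norm x \<in> A}) * emeasure uniform_sphere D \<partial>L)"
    (is "_ = (\<integral>\<^sup>+y. ?g y * _ \<partial>L)")
  proof (subst int, measurable, rule nn_integral_cong_AE)
    have "emeasure std_gaussian ((\<lambda>z. sqrt y *\<^sub>R z) -` {x::real^'n. norm x \<in> A \<and> x /\<^sub>R norm x \<in> D}) =
      ?g y * emeasure uniform_sphere D" if y: "0 < y" for y
    proof -
      let ?A = "(\<lambda>r. sqrt y * r) -` A"
      have "(\<lambda>z. sqrt y * z) \<in> borel_measurable borel" by measurable
      then have A: "?A \<in> sets borel"
        by (metis assms(1) measurable_sets space_borel Int_UNIV_right)
      have sc: "(inverse (sqrt y) * inverse (norm z) * sqrt y) *\<^sub>R z = z /\<^sub>R norm z" for z :: "real^'n"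
        using y by simp
      have "(\<lambda>z. sqrt y *\<^sub>R z) -` {x::real^'n. norm x \<in> A \<and> x /\<^sub>R norm x \<in> D} =
        {z. norm z \<in> ?A \<and> z /\<^sub>R norm z \<in> D}"
        using y by (auto simp: sc)
      moreover have "(\<lambda>z. sqrt y *\<^sub>R z) -` {x::real^'n. norm x \<in> A} = {z. norm z \<in> ?A}"
        using y by auto
      ultimately show ?thesis by (simp only: std_gaussian_polar[OF A assms(2)])
    qed
    then show "AE y in L. emeasure std_gaussian ((\<lambda>z. sqrt y *\<^sub>R z) -` {x::real^'n. norm x \<in> A \<and> x /\<^sub>R norm x \<in> D}) =
      ?g y * emeasure uniform_sphere D"
      using pos by auto
  qed
  also have "\<dots> = (\<integral>\<^sup>+y. ?g y \<partial>L) * emeasure uniform_sphere D"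
  proof (rule nn_integral_multc)
    \<comment> \<open>Rewriting the measure of a y-dependent set as an inner integral of a jointly
      measurable function yields measurability in y.\<close>
    have "?g = (\<lambda>y. \<integral>\<^sup>+z. indicator A (norm (sqrt y *\<^sub>R z)) \<partial>(std_gaussian :: (real^'n) measure))"
    proof
      fix y
      let ?S = "(\<lambda>z. sqrt y *\<^sub>R z) -` {x::real^'n. norm x \<in> A}"
      have "?S \<in> sets std_gaussian"
        using measurable_sets[of "\<lambda>z::real^'n. norm (sqrt y *\<^sub>R z)" borel borel A] by (simp add: vimage_def)
      then have "?g y = (\<integral>\<^sup>+z. indicator ?S z \<partial>std_gaussian)"
        by (rule nn_integral_indicator[symmetric])
      also have "\<dots> = (\<integral>\<^sup>+z. indicator A (norm (sqrt y *\<^sub>R z)) \<partial>(std_gaussian :: (real^'n) measure))"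
        by (intro nn_integral_cong) (auto simp: indicator_def)
      finally show "?g y = (\<integral>\<^sup>+z. indicator A (norm (sqrt y *\<^sub>R z)) \<partial>(std_gaussian :: (real^'n) measure))" .
    qed
    then show "?g \<in> borel_measurable L" by simp
  qed
  also have "(\<integral>\<^sup>+y. ?g y \<partial>L) = emeasure (gaussian_mixture L) {x::real^'n. norm x \<in> A}"
    by (rule int[symmetric]) measurable
  finally show ?thesis .
qed

text \<open>Stated for any variable with the mixture law on any probability space: it serves both an
  auxiliary product space and the sample space of the process itself.\<close>

lemma radial_uniform_pair_gaussian_mixture:
  fixes Z :: "'b \<Rightarrow> real ^ 'n"
  assumes "prob_space M" and [measurable]: "Z \<in> borel_measurable M"
    and Z: "distr M borel Z = gaussian_mixture L"
  shows "radial_uniform_pair M (\<lambda>\<omega>. norm (Z \<omega>)) (\<lambda>\<omega>. Z \<omega> /\<^sub>R norm (Z \<omega>))"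
proof -
  interpret M: prob_space M by fact
  have law: "emeasure M {\<omega> \<in> space M. Z \<omega> \<in> E} = emeasure (gaussian_mixture L) E"
    if [measurable]: "E \<in> sets borel" for E
    unfolding Z[symmetric] by (subst emeasure_distr) (auto intro!: arg_cong[where f="emeasure M"])
  have U: "distr M borel (\<lambda>\<omega>. Z \<omega> /\<^sub>R norm (Z \<omega>)) = uniform_sphere"
  proof (rule measure_eqI)
    fix D assume "D \<in> sets (distr M borel (\<lambda>\<omega>. Z \<omega> /\<^sub>R norm (Z \<omega>)))"
    then have [measurable]: "D \<in> sets borel" by simp
    interpret G: prob_space "gaussian_mixture L :: (real^'n) measure" by (rule prob_space_gaussian_mixture)
    \<comment> \<open>The direction alone is the case A = \<open>UNIV\<close> of the polar formula,
      whose radial factor is then the total mass 1.\<close>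
    have "emeasure (distr M borel (\<lambda>\<omega>. Z \<omega> /\<^sub>R norm (Z \<omega>))) D =
      emeasure M {\<omega> \<in> space M. Z \<omega> \<in> {x. norm x \<in> UNIV \<and> x /\<^sub>R norm x \<in> D}}"
      by (subst emeasure_distr) (auto intro!: arg_cong[where f="emeasure M"])
    also have "\<dots> = emeasure uniform_sphere D"
      using G.emeasure_space_1 by (subst law, measurable) (subst gaussian_mixture_polar, simp_all)
    finally show "emeasure (distr M borel (\<lambda>\<omega>. Z \<omega> /\<^sub>R norm (Z \<omega>))) D = emeasure uniform_sphere D" .
  qed (simp add: uniform_sphere_def)
  have "M.prob (a \<inter> b) = M.prob a * M.prob b"
    if "a \<in> {(\<lambda>\<omega>. norm (Z \<omega>)) -` A \<inter> space M |A. A \<in> sets borel}"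
      "b \<in> {(\<lambda>\<omega>. Z \<omega> /\<^sub>R norm (Z \<omega>)) -` A \<inter> space M |A. A \<in> sets borel}" for a b
  proof -
    from that obtain A D where [measurable]: "A \<in> sets borel" "D \<in> sets borel"
      and a: "a = (\<lambda>\<omega>. norm (Z \<omega>)) -` A \<inter> space M"
      and b: "b = (\<lambda>\<omega>. Z \<omega> /\<^sub>R norm (Z \<omega>)) -` D \<inter> space M" by blast
    have "a \<inter> b = {\<omega> \<in> space M. Z \<omega> \<in> {x. norm x \<in> A \<and> x /\<^sub>R norm x \<in> D}}"
      and a': "a = {\<omega> \<in> space M. Z \<omega> \<in> {x. norm x \<in> A}}"
      by (auto simp: a b)
    then have "emeasure M (a \<inter> b) = emeasure M a * emeasure uniform_sphere D"
      by (simp only: law, subst law, measurable, subst law, measurable) (rule gaussian_mixture_polar, measurable)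
    also have "emeasure uniform_sphere D = emeasure M b"
      unfolding U[symmetric] b by (subst emeasure_distr) auto
    finally show ?thesis
      by (simp add: M.emeasure_eq_measure ennreal_mult'[symmetric])
  qed
  then have "M.indep_set {(\<lambda>\<omega>. norm (Z \<omega>)) -` A \<inter> space M |A. A \<in> sets borel}
      {(\<lambda>\<omega>. Z \<omega> /\<^sub>R norm (Z \<omega>)) -` A \<inter> space M |A. A \<in> sets borel}"
    unfolding M.indep_sets2_eq by (auto intro!: measurable_sets)
  then show ?thesis
    unfolding radial_uniform_pair_def independent_of_def using U assms(1) by simp
qed

end

section \<open>Densities of linear images of Gaussian scale mixtures\<close>

lemma nn_integral_lborel_translate:
  assumes [measurable]: "h \<in> borel_measurable borel"
  shows "(\<integral>\<^sup>+x. h (c + x) \<partial>lborel) = (\<integral>\<^sup>+x. h x \<partial>(lborel :: 'a::euclidean_space measure))"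
  by (subst (2) lborel_distr_plus[of c, symmetric]) (simp add: nn_integral_distr)

lemma nn_integral_lborel_scale:
  fixes c :: real and h :: "'a::euclidean_space \<Rightarrow> ennreal"
  assumes [measurable]: "h \<in> borel_measurable borel" and "c \<noteq> 0"
  shows "(\<integral>\<^sup>+x. h x \<partial>lborel) = ennreal (\<bar>c\<bar> ^ DIM('a)) * (\<integral>\<^sup>+x. h (t + c *\<^sub>R x) \<partial>lborel)"
  by (subst lborel_affine[OF assms(2), of t])
     (simp add: nn_integral_density nn_integral_distr nn_integral_cmult)

text \<open>The image of Lebesgue measure under a linear bijection is again translation invariant, hence a
  multiple of Lebesgue measure; integrating \<open>indicator E x * indicator F (x + y)\<close> in both orders
  shows this without determinants.\<close>

lemma lborel_linear_image:
  fixes f :: "'a::euclidean_space \<Rightarrow> 'a"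
  assumes f: "linear f" and g: "linear g" and fg: "\<And>x. f (g x) = x" and gf: "\<And>x. g (f x) = x"
  obtains k :: real where "0 \<le> k" "distr lborel borel f = density lborel (\<lambda>_. ennreal k)"
proof -
  have [measurable]: "f \<in> borel_measurable borel" "g \<in> borel_measurable borel"
    using f g by (auto intro!: borel_measurable_continuous_onI linear_continuous_on simp: linear_conv_bounded_linear)
  define \<mu> where "\<mu> = distr lborel borel f"
  have sets_\<mu>[simp, measurable_cong]: "sets \<mu> = sets borel" and space_\<mu>[simp]: "space \<mu> = UNIV"
    by (simp_all add: \<mu>_def)
  \<comment> \<open>The inverse map takes balls to bounded sets, so \<mu> is finite on balls; this
    gives the sigma-finiteness that Fubini requires.\<close>
  have fin: "emeasure \<mu> (ball 0 r) < \<infinity>" for r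
  proof -
    have "emeasure \<mu> (ball 0 r) = emeasure lborel (g ` ball 0 r)"
      unfolding \<mu>_def by (subst emeasure_distr) (auto intro!: arg_cong[where f="emeasure lborel"] image_eqI simp: fg gf)
    also have "bounded (g ` ball 0 r)"
      using g by (intro bounded_linear_image) (auto simp: linear_conv_bounded_linear)
    then have "emeasure lborel (g ` ball 0 r) < \<infinity>" by (rule emeasure_bounded_finite)
    finally show ?thesis .
  qed
  have "sigma_finite_measure \<mu>"
  proof
    show "\<exists>A. countable A \<and> A \<subseteq> sets \<mu> \<and> \<Union> A = space \<mu> \<and> (\<forall>a\<in>A. emeasure \<mu> a \<noteq> \<infinity>)"
      using fin by (intro exI[of _ "range (\<lambda>n::nat. ball 0 (real n))"]) (auto intro: reals_Archimedean2 simp: less_top[symmetric])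
  qed
  then interpret \<mu>: sigma_finite_measure \<mu> .
  interpret P: pair_sigma_finite \<mu> "lborel :: 'a measure" ..
  have shift: "(\<integral>\<^sup>+x. h x \<partial>\<mu>) = (\<integral>\<^sup>+x. h (x - a) \<partial>\<mu>)" if [measurable]: "h \<in> borel_measurable borel" for h a
  proof -
    have "(\<integral>\<^sup>+x. h (x - a) \<partial>\<mu>) = (\<integral>\<^sup>+x. h (f (- g a + x)) \<partial>lborel)"
      unfolding \<mu>_def by (simp add: nn_integral_distr linear_diff[OF f] fg)
    also have "\<dots> = (\<integral>\<^sup>+x. h (f x) \<partial>lborel)"
      by (rule nn_integral_lborel_translate) measurable
    also have "\<dots> = (\<integral>\<^sup>+x. h x \<partial>\<mu>)"
      unfolding \<mu>_def by (simp add: nn_integral_distr)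
    finally show ?thesis by simp
  qed
  have key: "emeasure \<mu> E * emeasure lborel F = emeasure \<mu> F * emeasure lborel E"
    if [measurable]: "E \<in> sets borel" "F \<in> sets borel" for E F
  proof -
    have "emeasure \<mu> E * emeasure lborel F = (\<integral>\<^sup>+x. indicator E x * (\<integral>\<^sup>+y. indicator F y \<partial>lborel) \<partial>\<mu>)"
      by (simp add: nn_integral_multc)
    also have "\<dots> = (\<integral>\<^sup>+x. indicator E x * (\<integral>\<^sup>+y. indicator F (x + y) \<partial>lborel) \<partial>\<mu>)"
      by (subst nn_integral_lborel_translate) auto
    also have "\<dots> = (\<integral>\<^sup>+x. \<integral>\<^sup>+y. indicator E x * indicator F (x + y) \<partial>lborel \<partial>\<mu>)"
      by (intro nn_integral_cong nn_integral_cmult[symmetric]) measurable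
    also have "\<dots> = (\<integral>\<^sup>+y. \<integral>\<^sup>+x. indicator E x * indicator F (x + y) \<partial>\<mu> \<partial>lborel)"
      by (rule P.Fubini'[symmetric]) measurable
    \<comment> \<open>For fixed y, translation invariance of \<mu> moves the shift from F to E;
      after exchanging the integrals again, reflection and translation of Lebesgue measure free the
      inner integral from x.\<close>
    also have "\<dots> = (\<integral>\<^sup>+y. \<integral>\<^sup>+x. indicator E (x - y) * indicator F x \<partial>\<mu> \<partial>lborel)"
    proof (rule nn_integral_cong)
      fix y
      show "(\<integral>\<^sup>+x. indicator E x * indicator F (x + y) \<partial>\<mu>) = (\<integral>\<^sup>+x. indicator E (x - y) * indicator F x \<partial>\<mu>)"
        by (subst shift[of _ y]) auto
    qed
    also have "\<dots> = (\<integral>\<^sup>+x. \<integral>\<^sup>+y. indicator E (x - y) * indicator F x \<partial>lborel \<partial>\<mu>)"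
      by (rule P.Fubini') measurable
    also have "\<dots> = (\<integral>\<^sup>+x. (\<integral>\<^sup>+y. indicator E (x - y) \<partial>lborel) * indicator F x \<partial>\<mu>)"
      by (intro nn_integral_cong nn_integral_multc) measurable
    also have "\<dots> = (\<integral>\<^sup>+x. (\<integral>\<^sup>+y. indicator E y \<partial>lborel) * indicator F x \<partial>\<mu>)"
    proof (rule nn_integral_cong)
      fix x
      show "(\<integral>\<^sup>+y. indicator E (x - y) \<partial>lborel) * indicator F x =
          (\<integral>\<^sup>+y. indicator E y \<partial>lborel) * indicator F x"
        by (subst (2) nn_integral_lborel_scale[where c="-1" and t=x]) auto
    qed
    also have "\<dots> = emeasure \<mu> F * emeasure lborel E"
      by (simp add: nn_integral_multc mult.commute)
    finally show ?thesis .
  qed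
  \<comment> \<open>Taking F to be the unit ball, of positive finite volume, in \<open>key\<close>
    identifies the multiple as m / b.\<close>
  let ?B = "ball (0::'a) 1"
  define b where "b = measure lborel ?B"
  have eb: "emeasure lborel ?B = ennreal b"
    unfolding b_def using emeasure_lborel_ball_finite by (intro emeasure_eq_ennreal_measure) (simp add: less_top[symmetric])
  have "b > 0" using content_ball_pos[of 1 "0::'a"] by (simp add: b_def measure_completion)
  define m where "m = measure \<mu> ?B"
  have em: "emeasure \<mu> ?B = ennreal m"
    unfolding m_def using fin[of 1] by (intro emeasure_eq_ennreal_measure) (simp add: less_top[symmetric])
  show thesis
  proof
    show "0 \<le> m / b" using \<open>b > 0\<close> by (simp add: m_def)
    show "distr lborel borel f = density lborel (\<lambda>_. ennreal (m / b))"
    proof (rule measure_eqI)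
      fix E assume "E \<in> sets (distr lborel borel f)"
      then have [measurable]: "E \<in> sets borel" by simp
      have "emeasure \<mu> E = emeasure \<mu> E * (ennreal b * ennreal (1 / b))"
        using \<open>b > 0\<close> by (simp add: ennreal_mult'[symmetric])
      also have "\<dots> = ennreal m * emeasure lborel E * ennreal (1 / b)"
        using key[of E ?B] by (simp add: eb em mult.assoc[symmetric])
      also have "\<dots> = ennreal (m / b) * emeasure lborel E"
        using \<open>b > 0\<close> by (simp add: mult_ac ennreal_mult'[symmetric] m_def)
      finally show "emeasure (distr lborel borel f) E = emeasure (density lborel (\<lambda>_. ennreal (m / b))) E"
        by (simp add: \<mu>_def[symmetric] emeasure_density nn_integral_cmult_indicator)
    qed simp
  qed
qed

lemma nn_integral_powr_exp:
  fixes a \<tau> :: real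
  assumes "0 < a" "0 < \<tau>"
  shows "(\<integral>\<^sup>+x\<in>{0..}. ennreal (x powr (a - 1) * exp (- (x / \<tau>))) \<partial>lborel) = ennreal (\<tau> powr a * Gamma a)"
proof -
  have "(\<integral>\<^sup>+x\<in>{0..}. ennreal (x powr (a - 1) * exp (- (x / \<tau>))) \<partial>lborel) =
    ennreal \<tau> * (\<integral>\<^sup>+x. ennreal ((\<tau> * x) powr (a - 1) * exp (- x)) * indicator {0..} (\<tau> * x) \<partial>lborel)"
    using assms by (subst nn_integral_lborel_scale[where c=\<tau> and t=0]) auto
  also have "\<dots> = ennreal \<tau> * (\<integral>\<^sup>+x. ennreal (\<tau> powr (a - 1)) * ennreal (indicator {0..} x * x powr (a - 1) / exp x) \<partial>lborel)"
    using assms by (intro arg_cong[where f="\<lambda>u. ennreal \<tau> * u"] nn_integral_cong)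
      (auto simp: indicator_def powr_mult exp_minus ennreal_mult'[symmetric] field_simps zero_le_mult_iff)
  also have "\<dots> = ennreal \<tau> * (ennreal (\<tau> powr (a - 1)) * ennreal (Gamma a))"
    using assms by (simp add: nn_integral_cmult Gamma_conv_nn_integral_real)
  also have "\<dots> = ennreal (\<tau> powr a * Gamma a)"
    using assms by (simp add: ennreal_mult'[symmetric] mult.assoc[symmetric] powr_mult_base)
  finally show ?thesis .
qed

section \<open>The density generator of a scale mixture\<close>

context mixing_law
begin

text \<open>At half the squared norm of x this is the density at x of
  \<open>sqrt y *\<^sub>R z\<close> in dimension n: the centred Gaussian densities with variance
  \<tau>, averaged over L.\<close>

definition generator :: "nat \<Rightarrow> real \<Rightarrow> ennreal" where
  "generator n x = ennreal (1 / (2 * pi) powr (real n / 2)) *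
     (\<integral>\<^sup>+\<tau>\<in>{0..}. ennreal (\<tau> powr (- (real n / 2)) * exp (- (x / \<tau>))) \<partial>L)"

lemma borel_measurable_generator[measurable]: "generator n \<in> borel_measurable borel"
  unfolding generator_def[abs_def] by measurable

text \<open>By Tonelli the x-integral comes first and is a Gamma integral with scale \<tau>; its
  power of \<tau> cancels the one in the generator, leaving \<open>Gamma (n / 2)\<close> times the
  total mass of L.\<close>

lemma nn_integral_generator:
  assumes "0 < n"
  shows "(\<integral>\<^sup>+x\<in>{0..}. ennreal (x powr (real n / 2 - 1)) * generator n x \<partial>lborel) =
     ennreal ((2 * pi) powr (- (real n / 2)) * Gamma (real n / 2))"
proof -
  interpret P: pair_sigma_finite "lborel :: real measure" L ..
  let ?a = "real n / 2"
  let ?c = "ennreal (1 / (2 * pi) powr ?a)"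
  let ?f = "\<lambda>x \<tau>. ennreal (x powr (?a - 1)) * indicator {0..} x *
        (ennreal (\<tau> powr (- ?a) * exp (- (x / \<tau>))) * indicator {0..} \<tau>)"
  have "(\<integral>\<^sup>+x\<in>{0..}. ennreal (x powr (?a - 1)) * generator n x \<partial>lborel) = (\<integral>\<^sup>+x. ?c * (\<integral>\<^sup>+\<tau>. ?f x \<tau> \<partial>L) \<partial>lborel)"
    unfolding generator_def
    by (intro nn_integral_cong, subst nn_integral_cmult, measurable) (simp add: mult_ac)
  also have "\<dots> = ?c * (\<integral>\<^sup>+x. \<integral>\<^sup>+\<tau>. ?f x \<tau> \<partial>L \<partial>lborel)"
    by (rule nn_integral_cmult) measurable
  also have "(\<integral>\<^sup>+x. \<integral>\<^sup>+\<tau>. ?f x \<tau> \<partial>L \<partial>lborel) = (\<integral>\<^sup>+\<tau>. \<integral>\<^sup>+x. ?f x \<tau> \<partial>lborel \<partial>L)"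
    by (rule P.Fubini'[symmetric]) measurable
  also have "\<dots> = (\<integral>\<^sup>+\<tau>. ennreal (Gamma ?a) \<partial>L)"
  proof (rule nn_integral_cong_AE)
    have "(\<integral>\<^sup>+x. ?f x \<tau> \<partial>lborel) = ennreal (Gamma ?a)" if "0 < \<tau>" for \<tau>
    proof -
      have "(\<integral>\<^sup>+x. ?f x \<tau> \<partial>lborel) = (\<integral>\<^sup>+x. ennreal (\<tau> powr (- ?a)) *
          (ennreal (x powr (?a - 1) * exp (- (x / \<tau>))) * indicator {0..} x) \<partial>lborel)"
        using that by (intro nn_integral_cong) (auto simp: indicator_def ennreal_mult'[symmetric] mult_ac)
      also have "\<dots> = ennreal (\<tau> powr (- ?a)) * ennreal (\<tau> powr ?a * Gamma ?a)"
        using assms that by (subst nn_integral_cmult) (auto simp: nn_integral_powr_exp)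
      also have "\<dots> = ennreal (Gamma ?a)"
        using that by (simp add: ennreal_mult'[symmetric] mult.assoc[symmetric] powr_add[symmetric])
      finally show ?thesis .
    qed
    then show "AE \<tau> in L. (\<integral>\<^sup>+x. ?f x \<tau> \<partial>lborel) = ennreal (Gamma ?a)"
      using pos by auto
  qed
  also have "\<dots> = ennreal (Gamma ?a)" by (simp add: emeasure_space_1)
  also have "?c * \<dots> = ennreal ((2 * pi) powr (- ?a) * Gamma ?a)"
    by (simp add: ennreal_mult'[symmetric] powr_minus_divide)
  finally show ?thesis .
qed

text \<open>For fixed y there are two changes of variables: scaling by \<open>sqrt y\<close>
  contributes the power \<open>y powr (- n / 2)\<close>, and A contributes a factor k that does not
  depend on y. Tonelli then averages over y.\<close>

lemma linear_gaussian_mixture_density: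
  fixes A A' :: "real ^ 'n ^ 'n"
  assumes inv: "A ** A' = mat 1" "A' ** A = mat 1"
  obtains k :: real where "0 \<le> k" "distr (gaussian_mixture L) borel ((*v) A) =
    density lborel (\<lambda>x. ennreal k * generator CARD('n) ((norm (A' *v x))\<^sup>2 / 2))"
proof -
  interpret P: pair_sigma_finite "lborel :: (real^'n) measure" L ..
  obtain k where k: "0 \<le> k" "distr lborel borel ((*v) A) = density lborel (\<lambda>_. ennreal k)"
    by (rule lborel_linear_image[of "(*v) A" "(*v) A'"])
       (simp_all add: matrix_vector_mul_linear matrix_vector_mul_assoc inv)
  let ?n = "real CARD('n) / 2"
  let ?q = "\<lambda>x::real^'n. (norm (A' *v x))\<^sup>2 / 2"
  define \<rho> where "\<rho> x = (2 * pi) powr (- ?n) * exp (- (norm x)\<^sup>2 / 2)" for x :: "real^'n"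
  have [measurable]: "\<rho> \<in> borel_measurable borel" unfolding \<rho>_def by measurable
  have dens: "(std_gaussian :: (real^'n) measure) = density lborel \<rho>"
    unfolding std_gaussian_def std_gaussian_density by (simp add: \<rho>_def)
  have inner: "(\<integral>\<^sup>+z. indicator E (A *v (sqrt y *\<^sub>R z)) \<partial>std_gaussian) =
      (\<integral>\<^sup>+x. indicator E x * (ennreal k * ennreal ((2 * pi) powr (- ?n)) *
         (ennreal (y powr (- ?n) * exp (- (?q x / y))) * indicator {0..} y)) \<partial>lborel)"
    if y: "0 < y" and [measurable]: "E \<in> sets borel" for y and E :: "(real^'n) set"
  proof -
    have sq: "sqrt y ^ CARD('n) * y powr (- ?n) = 1"
    proof -
      have "sqrt y ^ CARD('n) = y powr ?n"
        using y by (simp add: powr_half_sqrt[symmetric] powr_power)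
      then show ?thesis using y by (simp add: powr_add[symmetric])
    qed
    let ?H = "\<lambda>w. indicator E (A *v w) * ennreal (\<rho> (w /\<^sub>R sqrt y))"
    have "(\<integral>\<^sup>+z. indicator E (A *v (sqrt y *\<^sub>R z)) \<partial>std_gaussian) =
        (\<integral>\<^sup>+z. ?H (0 + sqrt y *\<^sub>R z) \<partial>lborel)"
      unfolding dens using y by (subst nn_integral_density) (auto simp: mult.commute)
    \<comment> \<open>The factor 1 is inserted as \<open>y powr (- ?n)\<close> times
      \<open>sqrt y\<close> to the power n, so that the scaling formula can be read from right to
      left.\<close>
    also have "\<dots> = ennreal (y powr (- ?n)) * (ennreal (\<bar>sqrt y\<bar> ^ DIM(real^'n)) * (\<integral>\<^sup>+z. ?H (0 + sqrt y *\<^sub>R z) \<partial>lborel))"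
      using y sq by (simp add: mult.assoc[symmetric] ennreal_mult'[symmetric] mult.commute)
    also have "\<dots> = ennreal (y powr (- ?n)) * (\<integral>\<^sup>+w. ?H w \<partial>lborel)"
      using y by (subst (2) nn_integral_lborel_scale[where c="sqrt y" and t=0]) auto
    also have "(\<integral>\<^sup>+w. ?H w \<partial>lborel) = (\<integral>\<^sup>+x. indicator E x * ennreal (\<rho> ((A' *v x) /\<^sub>R sqrt y)) \<partial>distr lborel borel ((*v) A))"
      by (subst nn_integral_distr) (auto simp: matrix_vector_mul_assoc inv)
    also have "\<dots> = (\<integral>\<^sup>+x. ennreal k * (indicator E x * ennreal (\<rho> ((A' *v x) /\<^sub>R sqrt y))) \<partial>lborel)"
      unfolding k(2) by (subst nn_integral_density) auto
    also have "ennreal (y powr (- ?n)) * \<dots> = (\<integral>\<^sup>+x. ennreal (y powr (- ?n)) *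
        (ennreal k * (indicator E x * ennreal (\<rho> ((A' *v x) /\<^sub>R sqrt y)))) \<partial>lborel)"
      by (rule nn_integral_cmult[symmetric]) measurable
    also have "\<dots> = (\<integral>\<^sup>+x. indicator E x * (ennreal k * ennreal ((2 * pi) powr (- ?n)) *
         (ennreal (y powr (- ?n) * exp (- (?q x / y))) * indicator {0..} y)) \<partial>lborel)"
    proof (rule nn_integral_cong)
      fix x :: "real^'n"
      have "\<rho> ((A' *v x) /\<^sub>R sqrt y) = (2 * pi) powr (- ?n) * exp (- (?q x / y))"
        using y by (simp add: \<rho>_def power_mult_distrib power_inverse divide_simps)
      then show "ennreal (y powr (- ?n)) * (ennreal k * (indicator E x * ennreal (\<rho> ((A' *v x) /\<^sub>R sqrt y)))) =
         indicator E x * (ennreal k * ennreal ((2 * pi) powr (- ?n)) *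
         (ennreal (y powr (- ?n) * exp (- (?q x / y))) * indicator {0..} y))"
        using y by (simp add: ennreal_mult' mult_ac)
    qed
    finally show ?thesis .
  qed
  show thesis
  proof
    show "0 \<le> k" by fact
    show "distr (gaussian_mixture L) borel ((*v) A) =
      density lborel (\<lambda>x. ennreal k * generator CARD('n) ((norm (A' *v x))\<^sup>2 / 2))"
    proof (rule measure_eqI)
      fix E assume "E \<in> sets (distr (gaussian_mixture L) borel ((*v) A))"
      then have E[measurable]: "E \<in> sets borel" by simp
      let ?F = "\<lambda>x y. indicator E x * (ennreal k * ennreal ((2 * pi) powr (- ?n)) *
         (ennreal (y powr (- ?n) * exp (- (?q x / y))) * indicator {0..} y))"
      have "emeasure (distr (gaussian_mixture L) borel ((*v) A)) E =
          (\<integral>\<^sup>+x. indicator E x \<partial>distr (gaussian_mixture L) borel ((*v) A))"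
        by simp
      also have "\<dots> = (\<integral>\<^sup>+x. indicator E (A *v x) \<partial>gaussian_mixture L)"
        by (subst nn_integral_distr) auto
      also have "\<dots> = (\<integral>\<^sup>+y. \<integral>\<^sup>+z. indicator E (A *v (sqrt y *\<^sub>R z)) \<partial>std_gaussian \<partial>L)"
        by (rule nn_integral_gaussian_mixture) measurable
      also have "\<dots> = (\<integral>\<^sup>+y. \<integral>\<^sup>+x. ?F x y \<partial>lborel \<partial>L)"
        by (rule nn_integral_cong_AE) (use pos inner[OF _ E] in auto)
      also have "\<dots> = (\<integral>\<^sup>+x. \<integral>\<^sup>+y. ?F x y \<partial>L \<partial>lborel)"
        by (rule P.Fubini') measurable
      also have "\<dots> = (\<integral>\<^sup>+x. ennreal k * generator CARD('n) (?q x) * indicator E x \<partial>lborel)"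
        by (intro nn_integral_cong, subst nn_integral_cmult, measurable, subst nn_integral_cmult, measurable)
           (simp add: generator_def powr_minus_divide mult_ac)
      also have "\<dots> = emeasure (density lborel (\<lambda>x. ennreal k * generator CARD('n) (?q x))) E"
        by (subst emeasure_density) auto
      finally show "emeasure (distr (gaussian_mixture L) borel ((*v) A)) E =
        emeasure (density lborel (\<lambda>x. ennreal k * generator CARD('n) (?q x))) E" .
    qed simp
  qed
qed

end

section \<open>Non-smoothness of the fractional covariance\<close>

lemma second_difference_powr_tendsto:
  fixes a \<alpha> :: real
  assumes "0 < a" "0 < \<alpha>" "\<alpha> < 2"
  shows "((\<lambda>e. ((a + e) powr \<alpha> + (a - e) powr \<alpha> - 2 * a powr \<alpha>) / e powr \<alpha>) \<longlongrightarrow> 0) (at_right 0)"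
proof -
  \<comment> \<open>The second difference behaves like \<alpha> (\<alpha> - 1)
    \<open>a powr (\<alpha> - 2)\<close> times the square of e, of smaller order than
    \<open>e powr \<alpha>\<close>. The cases follow the sign of \<alpha> - 1; at \<alpha> = 1 the
    difference is exactly 0 once e < a.\<close>
  consider "\<alpha> < 1" | "\<alpha> = 1" | "1 < \<alpha>" by linarith
  then show ?thesis
  proof cases
    case 1
    with assms show ?thesis by real_asymp
  next
    case 2
    have "eventually (\<lambda>e. e \<in> {0<..<a}) (at_right 0)"
      using assms by (intro eventually_at_right_real) auto
    then have "\<forall>\<^sub>F e in at_right 0. ((a + e) powr \<alpha> + (a - e) powr \<alpha> - 2 * a powr \<alpha>) / e powr \<alpha> = 0"
      by eventually_elim (use 2 assms in auto)
    then show ?thesis by (rule tendsto_eventually)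
  next
    case 3
    with assms show ?thesis by real_asymp
  qed
qed

lemma second_difference_abs_powr_tendsto:
  fixes b \<alpha> :: real
  assumes "b \<noteq> 0" "0 < \<alpha>" "\<alpha> < 2"
  shows "((\<lambda>e. (\<bar>b - e\<bar> powr \<alpha> + \<bar>b + e\<bar> powr \<alpha> - 2 * \<bar>b\<bar> powr \<alpha>) / e powr \<alpha>) \<longlongrightarrow> 0) (at_right 0)"
proof (rule Lim_transform_eventually)
  show "((\<lambda>e. ((\<bar>b\<bar> + e) powr \<alpha> + (\<bar>b\<bar> - e) powr \<alpha> - 2 * \<bar>b\<bar> powr \<alpha>) / e powr \<alpha>) \<longlongrightarrow> 0) (at_right 0)"
    by (rule second_difference_powr_tendsto) (use assms in auto)
  have "eventually (\<lambda>e. e \<in> {0<..<\<bar>b\<bar>}) (at_right 0)"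
    using assms by (intro eventually_at_right_real) auto
  then show "\<forall>\<^sub>F e in at_right 0. ((\<bar>b\<bar> + e) powr \<alpha> + (\<bar>b\<bar> - e) powr \<alpha> - 2 * \<bar>b\<bar> powr \<alpha>) / e powr \<alpha> =
    (\<bar>b - e\<bar> powr \<alpha> + \<bar>b + e\<bar> powr \<alpha> - 2 * \<bar>b\<bar> powr \<alpha>) / e powr \<alpha>"
  proof eventually_elim
    case (elim e)
    then show ?case by (cases "b > 0") (auto simp: abs_if)
  qed
qed

text \<open>The second difference of \<open>s \<mapsto> \<bar>t k - s\<bar> powr \<alpha>\<close> at \<open>t k\<close> is \<open>2 * e powr \<alpha>\<close>, while all other
  terms are smooth there and contribute \<open>O(e\<^sup>2)\<close>.\<close>

lemma fBm_covariance_independent: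
  fixes t x :: "'i \<Rightarrow> real"
  assumes \<alpha>: "0 < \<alpha>" "\<alpha> < 2" and "finite I" "inj_on t I" and pos: "\<And>i. i \<in> I \<Longrightarrow> 0 < t i"
    and zero: "\<And>s. 0 \<le> s \<Longrightarrow> (\<Sum>i\<in>I. x i * fBm_covariance \<alpha> (t i) s) = 0"
    and k: "k \<in> I"
  shows "x k = 0"
proof -
  define f where "f s = (\<Sum>i\<in>I. x i * (t i powr \<alpha> + s powr \<alpha> - \<bar>t i - s\<bar> powr \<alpha>))" for s
  have f0: "f s = 0" if "0 \<le> s" for s
  proof -
    have "f s = 2 * (\<Sum>i\<in>I. x i * fBm_covariance \<alpha> (t i) s)"
      by (simp add: f_def fBm_covariance_def sum_distrib_left)
    then show ?thesis using zero[OF that] by simp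
  qed
  define d where "d a e = (\<bar>a - e\<bar> powr \<alpha> + \<bar>a + e\<bar> powr \<alpha> - 2 * \<bar>a\<bar> powr \<alpha>) / e powr \<alpha>" for a e :: real
  \<comment> \<open>At a = 0 the quotient is the constant 2, as \<open>0 powr \<alpha> = 0\<close>;
    this is the trace of the kink.\<close>
  have dlim: "(d a \<longlongrightarrow> (if a = 0 then 2 else 0)) (at_right 0)" for a
  proof (cases "a = 0")
    case True
    have "eventually (\<lambda>e::real. e \<in> {0<..<1}) (at_right 0)"
      by (intro eventually_at_right_real) auto
    then have "eventually (\<lambda>e. 2 = d a e) (at_right 0)"
      by eventually_elim (use True in \<open>auto simp: d_def\<close>)
    then show ?thesis
      using True by (intro Lim_transform_eventually[OF tendsto_const]) auto
  next
    case False
    then show ?thesis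
      using second_difference_abs_powr_tendsto[OF False \<alpha>] by (simp add: d_def[abs_def])
  qed
  have "((\<lambda>e. \<Sum>i\<in>I. x i * (d (t k) e - d (t i - t k) e)) \<longlongrightarrow>
      (\<Sum>i\<in>I. x i * ((if t k = 0 then 2 else 0) - (if t i - t k = 0 then 2 else 0)))) (at_right 0)"
    by (intro tendsto_intros dlim)
  \<comment> \<open>Positivity of \<open>t k\<close> kills the contribution of
    \<open>s powr \<alpha>\<close>, and injectivity of t leaves the kink in the summand k
    only.\<close>
  also have "(\<Sum>i\<in>I. x i * ((if t k = 0 then 2 else 0) - (if t i - t k = 0 then 2 else 0))) =
      (\<Sum>i\<in>I. if i = k then - 2 * x k else 0)"
    using pos[OF k] inj_onD[OF \<open>inj_on t I\<close>] k by (intro sum.cong) auto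
  also have "\<dots> = - 2 * x k"
    using k \<open>finite I\<close> by simp
  finally have lim: "((\<lambda>e. \<Sum>i\<in>I. x i * (d (t k) e - d (t i - t k) e)) \<longlongrightarrow> - 2 * x k) (at_right 0)" .
  \<comment> \<open>The range e < \<open>t k\<close> keeps \<open>t k - e\<close> among the
    nonnegative times, where f is known to vanish.\<close>
  have "eventually (\<lambda>e. e \<in> {0<..<t k}) (at_right 0)"
    using pos[OF k] by (intro eventually_at_right_real) auto
  then have "eventually (\<lambda>e. (\<Sum>i\<in>I. x i * (d (t k) e - d (t i - t k) e)) = 0) (at_right 0)"
  proof eventually_elim
    case (elim e)
    have "0 = (f (t k + e) + f (t k - e) - 2 * f (t k)) / e powr \<alpha>"
      using elim by (simp add: f0)
    also have "\<dots> = (\<Sum>i\<in>I. x i * (d (t k) e - d (t i - t k) e))"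
      unfolding f_def sum_distrib_left sum.distrib[symmetric] sum_subtractf[symmetric] sum_divide_distrib
    proof (rule sum.cong)
      fix i
      have "\<bar>t k - e\<bar> = t k - e" "\<bar>t k + e\<bar> = t k + e" "\<bar>t k\<bar> = t k"
        using elim by auto
      then show "(x i * (t i powr \<alpha> + (t k + e) powr \<alpha> - \<bar>t i - (t k + e)\<bar> powr \<alpha>) +
          x i * (t i powr \<alpha> + (t k - e) powr \<alpha> - \<bar>t i - (t k - e)\<bar> powr \<alpha>) -
          2 * (x i * (t i powr \<alpha> + t k powr \<alpha> - \<bar>t i - t k\<bar> powr \<alpha>))) / e powr \<alpha> =
          x i * (d (t k) e - d (t i - t k) e)"
        using elim by (simp add: d_def diff_divide_distrib[symmetric] diff_diff_eq diff_diff_eq2 diff_add_eq)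
          (simp add: algebra_simps)
    qed simp
    finally show ?case by simp
  qed
  then have "((\<lambda>e. \<Sum>i\<in>I. x i * (d (t k) e - d (t i - t k) e)) \<longlongrightarrow> 0) (at_right 0)"
    by (rule tendsto_eventually)
  from tendsto_unique[OF _ lim this] show "x k = 0"
    by simp
qed

section \<open>Linear combinations of fractional Brownian motion\<close>

text \<open>An affine image of the standard normal covers both branches of
  \<open>normal_law\<close>, so moments and characteristic function are obtained once, with the
  degenerate law included.\<close>

lemma normal_law_eq_distr:
  assumes "0 \<le> \<sigma>"
  shows "normal_law \<mu> \<sigma> = distr std_normal_distribution borel (\<lambda>x. \<mu> + \<sigma> * x)"
proof -
  interpret S: prob_space std_normal_distribution by (rule prob_space_normal_density) simp
  show ?thesis
  proof (cases "\<sigma> = 0")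
    case True
    then show ?thesis
      by (simp add: normal_law_def S.distr_const)
  next
    case False
    have "distributed std_normal_distribution lborel (\<lambda>x. x) (normal_density 0 1)"
      by (simp add: distributed_def distr_id2)
    from S.normal_density_affine[OF this, of \<sigma> \<mu>] False assms show ?thesis
      by (simp add: normal_law_def distributed_def cong: distr_cong)
  qed
qed

lemma prob_space_normal_law: "0 \<le> \<sigma> \<Longrightarrow> prob_space (normal_law \<mu> \<sigma>)"
  unfolding normal_law_eq_distr
  by (intro prob_space.prob_space_distr prob_space_normal_density) auto

lemma sets_normal_law[simp, measurable_cong]: "sets (normal_law \<mu> \<sigma>) = sets borel"
  by (simp add: normal_law_def)

lemma normal_law_moments:
  assumes "0 \<le> \<sigma>"
  shows "(LINT x|normal_law \<mu> \<sigma>. x) = \<mu>"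
    "integrable (normal_law \<mu> \<sigma>) (\<lambda>x. x\<^sup>2)" "(LINT x|normal_law \<mu> \<sigma>. x\<^sup>2) = \<mu>\<^sup>2 + \<sigma>\<^sup>2"
proof -
  interpret S: prob_space std_normal_distribution by (rule prob_space_normal_density) simp
  have i2: "integrable std_normal_distribution (\<lambda>x. x\<^sup>2)" "(LINT x|std_normal_distribution. x\<^sup>2) = 1"
    using std_normal_distribution_even_moments[of 1] by simp_all
  have i1: "integrable std_normal_distribution (\<lambda>x. x)"
    by (rule S.square_integrable_imp_integrable) (use i2 in auto)
  have e1: "(LINT x|std_normal_distribution. x) = 0"
    using integral_std_normal_distribution_moment_odd[of 1] by simp
  have sq: "(\<mu> + \<sigma> * x)\<^sup>2 = \<mu>\<^sup>2 + 2 * \<mu> * \<sigma> * x + \<sigma>\<^sup>2 * x\<^sup>2" for x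
    by (simp add: power2_eq_square algebra_simps)
  note N = normal_law_eq_distr[OF assms, of \<mu>]
  have ec: "(LINT x|std_normal_distribution. c) = c" for c :: real
    using S.prob_space by simp
  have lin: "(LINT x|std_normal_distribution. a + b * x) = a" for a b
    using Bochner_Integration.integral_add[OF S.integrable_const[of a] integrable_mult_right[OF i1, of b]]
      integral_mult_right_zero[of std_normal_distribution b "\<lambda>x. x"]
    by (simp only: ec e1 mult_zero_right add_0_right)
  have sq1: "(LINT x|std_normal_distribution. b * x\<^sup>2) = b" for b
    using integral_mult_right_zero[of std_normal_distribution b "\<lambda>x. x\<^sup>2"] by (simp only: i2 mult_1_right)
  have m1: "(\<lambda>x. \<mu> + \<sigma> * x) \<in> measurable std_normal_distribution borel" by measurable
  have "(LINT x|normal_law \<mu> \<sigma>. x) = (LINT x|std_normal_distribution. \<mu> + \<sigma> * x)"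
    unfolding N by (rule integral_distr[OF m1]) simp
  also have "\<dots> = \<mu>"
    by (rule lin)
  finally show "(LINT x|normal_law \<mu> \<sigma>. x) = \<mu>" .
  have i: "integrable std_normal_distribution (\<lambda>x. \<mu>\<^sup>2 + 2 * \<mu> * \<sigma> * x)"
    "integrable std_normal_distribution (\<lambda>x. \<sigma>\<^sup>2 * x\<^sup>2)"
    by (intro Bochner_Integration.integrable_add S.integrable_const integrable_mult_right i1 i2)+
  then have "integrable std_normal_distribution (\<lambda>x. (\<mu> + \<sigma> * x)\<^sup>2)"
    unfolding sq by (rule Bochner_Integration.integrable_add)
  then show "integrable (normal_law \<mu> \<sigma>) (\<lambda>x. x\<^sup>2)"
    unfolding N by (subst integrable_distr_eq[OF m1]) simp_all
  have "(LINT x|normal_law \<mu> \<sigma>. x\<^sup>2) = (LINT x|std_normal_distribution. (\<mu> + \<sigma> * x)\<^sup>2)"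
    unfolding N by (rule integral_distr[OF m1]) simp
  also have "\<dots> = (LINT x|std_normal_distribution. \<mu>\<^sup>2 + 2 * \<mu> * \<sigma> * x) + (LINT x|std_normal_distribution. \<sigma>\<^sup>2 * x\<^sup>2)"
    unfolding sq by (rule Bochner_Integration.integral_add[OF i])
  also have "\<dots> = \<mu>\<^sup>2 + \<sigma>\<^sup>2"
    by (simp only: lin sq1)
  finally show "(LINT x|normal_law \<mu> \<sigma>. x\<^sup>2) = \<mu>\<^sup>2 + \<sigma>\<^sup>2" .
qed

lemma char_normal_law:
  assumes "0 \<le> \<sigma>"
  shows "(CLINT x|normal_law 0 \<sigma>. iexp (u * x)) = complex_of_real (exp (- (\<sigma> * u)\<^sup>2 / 2))"
proof -
  have "(CLINT x|normal_law 0 \<sigma>. iexp (u * x)) = (CLINT x|std_normal_distribution. iexp ((\<sigma> * u) * x))"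
    unfolding normal_law_eq_distr[OF assms] by (subst integral_distr) (auto simp: mult_ac)
  also have "\<dots> = complex_of_real (exp (- (\<sigma> * u)\<^sup>2 / 2))"
    using fun_cong[OF char_std_normal_distribution, of "\<sigma> * u"] by (simp add: char_def)
  finally show ?thesis .
qed

locale fBm = prob_space N for N :: "'b measure" +
  fixes H :: real and W :: "real \<Rightarrow> 'b \<Rightarrow> real"
  assumes fBm: "fractional_Brownian_motion H N W"
begin

lemma measurable_W: "0 \<le> t \<Longrightarrow> W t \<in> borel_measurable N"
  using fBm by (auto simp: fractional_Brownian_motion_def gaussian_process_def)

lemma gaussian_combination:
  assumes "finite J" "J \<subseteq> {0..}"
  obtains \<mu> \<sigma> where "0 \<le> \<sigma>" "distr N borel (\<lambda>\<omega>. \<Sum>t\<in>J. c t * W t \<omega>) = normal_law \<mu> \<sigma>"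
  using fBm assms unfolding fractional_Brownian_motion_def gaussian_process_def by blast

text \<open>The prescribed covariances do not give this, since the integral of a non-integrable
  function is 0 by convention. Integrability comes from the Gaussian marginals, through finite
  second moments and \<open>\<bar>x * y\<bar> \<le> x\<^sup>2 + y\<^sup>2\<close>.\<close>

lemma integrable_W_mult:
  assumes "0 \<le> s" "0 \<le> t"
  shows "integrable N (\<lambda>\<omega>. W s \<omega> * W t \<omega>)"
proof -
  have sq: "integrable N (\<lambda>\<omega>. (W t \<omega>)\<^sup>2)" if t: "0 \<le> t" for t
  proof -
    note [measurable] = measurable_W[OF t]
    obtain \<mu> \<sigma> where "0 \<le> \<sigma>" "distr N borel (\<lambda>\<omega>. \<Sum>t\<in>{t}. 1 * W t \<omega>) = normal_law \<mu> \<sigma>"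
      by (rule gaussian_combination[of "{t}" "\<lambda>_. 1"]) (use t in auto)
    then have "integrable (distr N borel (W t)) (\<lambda>x. x\<^sup>2)"
      using normal_law_moments(2) by simp
    then show ?thesis by (subst (asm) integrable_distr_eq) auto
  qed
  note [measurable] = measurable_W[OF assms(1)] measurable_W[OF assms(2)]
  show ?thesis
  proof (rule Bochner_Integration.integrable_bound)
    show "integrable N (\<lambda>\<omega>. (W s \<omega>)\<^sup>2 + (W t \<omega>)\<^sup>2)"
      using sq assms by simp
    have "norm (x * y) \<le> norm (x\<^sup>2 + y\<^sup>2)" for x y :: real
    proof -
      have "2 * \<bar>x\<bar> * \<bar>y\<bar> \<le> x\<^sup>2 + y\<^sup>2" "0 \<le> \<bar>x\<bar> * \<bar>y\<bar>"
        using sum_squares_bound[of "\<bar>x\<bar>" "\<bar>y\<bar>"] by simp_all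
      then have "\<bar>x\<bar> * \<bar>y\<bar> \<le> \<bar>x\<^sup>2 + y\<^sup>2\<bar>" by linarith
      then show ?thesis by (simp only: real_norm_def abs_mult)
    qed
    then show "AE \<omega> in N. norm (W s \<omega> * W t \<omega>) \<le> norm ((W s \<omega>)\<^sup>2 + (W t \<omega>)\<^sup>2)"
      by (intro always_eventually allI)
  qed measurable
qed

lemma expectation_W_mult:
  "0 \<le> s \<Longrightarrow> 0 \<le> t \<Longrightarrow> (LINT \<omega>|N. W s \<omega> * W t \<omega>) = fBm_covariance (2 * H) s t"
  using fBm by (auto simp: fractional_Brownian_motion_def)

lemma square_combination:
  assumes J: "finite J" "J \<subseteq> {0..}"
  shows "integrable N (\<lambda>\<omega>. (\<Sum>t\<in>J. c t * W t \<omega>)\<^sup>2)"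
    "(LINT \<omega>|N. (\<Sum>t\<in>J. c t * W t \<omega>)\<^sup>2) = (\<Sum>s\<in>J. \<Sum>t\<in>J. c s * c t * fBm_covariance (2 * H) s t)"
proof -
  have eq: "(\<Sum>t\<in>J. c t * W t \<omega>)\<^sup>2 = (\<Sum>s\<in>J. \<Sum>t\<in>J. c s * c t * (W s \<omega> * W t \<omega>))" for \<omega>
    by (simp add: power2_eq_square sum_product mult_ac)
  have int: "integrable N (\<lambda>\<omega>. c s * c t * (W s \<omega> * W t \<omega>))" if "s \<in> J" "t \<in> J" for s t
    using integrable_W_mult[of s t] that J by (intro integrable_mult_right) auto
  then show "integrable N (\<lambda>\<omega>. (\<Sum>t\<in>J. c t * W t \<omega>)\<^sup>2)"
    unfolding eq by (intro Bochner_Integration.integrable_sum)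
  have "(LINT \<omega>|N. (\<Sum>t\<in>J. c t * W t \<omega>)\<^sup>2) = (\<Sum>s\<in>J. \<Sum>t\<in>J. LINT \<omega>|N. c s * c t * (W s \<omega> * W t \<omega>))"
    unfolding eq
  proof (subst Bochner_Integration.integral_sum)
    show "(\<Sum>s\<in>J. (\<integral>\<omega>. (\<Sum>t\<in>J. c s * c t * (W s \<omega> * W t \<omega>)) \<partial>N)) =
        (\<Sum>s\<in>J. \<Sum>t\<in>J. LINT \<omega>|N. c s * c t * (W s \<omega> * W t \<omega>))"
      by (intro sum.cong Bochner_Integration.integral_sum int refl)
  qed (intro Bochner_Integration.integrable_sum int)
  also have "\<dots> = (\<Sum>s\<in>J. \<Sum>t\<in>J. c s * c t * fBm_covariance (2 * H) s t)"
    using J by (intro sum.cong) (auto simp: expectation_W_mult subset_eq)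
  finally show "(LINT \<omega>|N. (\<Sum>t\<in>J. c t * W t \<omega>)\<^sup>2) =
    (\<Sum>s\<in>J. \<Sum>t\<in>J. c s * c t * fBm_covariance (2 * H) s t)" .
qed

text \<open>A Gaussian process only promises some mean and deviation for each combination; the first
  two moments, computed from the centring and the covariance, identify them.\<close>

lemma distr_combination:
  fixes c :: "real \<Rightarrow> real"
  assumes J: "finite J" "J \<subseteq> {0..}"
  defines "v \<equiv> (\<Sum>s\<in>J. \<Sum>t\<in>J. c s * c t * fBm_covariance (2 * H) s t)"
  shows "0 \<le> v" "distr N borel (\<lambda>\<omega>. \<Sum>t\<in>J. c t * W t \<omega>) = normal_law 0 (sqrt v)"
proof -
  let ?V = "\<lambda>\<omega>. \<Sum>t\<in>J. c t * W t \<omega>"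
  have V[measurable]: "?V \<in> borel_measurable N"
    using J measurable_W by (intro borel_measurable_sum borel_measurable_times) auto
  have v: "v = (LINT \<omega>|N. (?V \<omega>)\<^sup>2)"
    unfolding v_def by (rule square_combination(2)[OF J, symmetric])
  then show "0 \<le> v" by simp
  obtain \<mu> \<sigma> where \<sigma>: "0 \<le> \<sigma>" and d: "distr N borel ?V = normal_law \<mu> \<sigma>"
    by (rule gaussian_combination[OF J, of c])
  have intW: "integrable N (W t)" if "t \<in> J" for t
  proof -
    have [measurable]: "W t \<in> borel_measurable N" using that J measurable_W by auto
    show ?thesis
    proof (rule square_integrable_imp_integrable)
      show "integrable N (\<lambda>\<omega>. (W t \<omega>)\<^sup>2)"
        unfolding power2_eq_square using that J by (intro integrable_W_mult) auto
    qed measurable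
  qed
  have "\<mu> = (LINT x|distr N borel ?V. x)"
    unfolding d by (rule normal_law_moments(1)[OF \<sigma>, symmetric])
  also have "\<dots> = (LINT \<omega>|N. ?V \<omega>)" by (rule integral_distr) auto
  also have "\<dots> = (\<Sum>t\<in>J. c t * (LINT \<omega>|N. W t \<omega>))"
    using intW by (subst Bochner_Integration.integral_sum) auto
  also have "\<dots> = 0"
    using fBm J by (intro sum.neutral) (auto simp: fractional_Brownian_motion_def)
  finally have \<mu>: "\<mu> = 0" .
  have "v = (LINT x|distr N borel ?V. x\<^sup>2)"
    unfolding v by (rule integral_distr[symmetric]) auto
  also have "\<dots> = \<sigma>\<^sup>2"
    unfolding d using normal_law_moments(3)[OF \<sigma>, of \<mu>] \<mu> by simp
  finally have "\<sigma> = sqrt v" using \<sigma> by simp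
  then show "distr N borel ?V = normal_law 0 (sqrt v)" using d \<mu> by simp
qed

text \<open>A combination of zero variance vanishes almost surely, hence is orthogonal to every \<open>W s\<close>.\<close>

lemma degenerate_combination:
  assumes J: "finite J" "J \<subseteq> {0..}"
    and zero: "(\<Sum>s\<in>J. \<Sum>t\<in>J. c s * c t * fBm_covariance (2 * H) s t) = 0" and s: "0 \<le> s"
  shows "(\<Sum>t\<in>J. c t * fBm_covariance (2 * H) t s) = 0"
proof -
  let ?V = "\<lambda>\<omega>. \<Sum>t\<in>J. c t * W t \<omega>"
  have V[measurable]: "?V \<in> borel_measurable N"
    using J measurable_W by (intro borel_measurable_sum borel_measurable_times) auto
  have "AE \<omega> in N. (?V \<omega>)\<^sup>2 = 0"
    using integral_nonneg_eq_0_iff_AE[OF square_combination(1)[OF J, of c]]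
      square_combination(2)[OF J, of c] zero by simp
  then have "(LINT \<omega>|N. ?V \<omega> * W s \<omega>) = (LINT \<omega>|N. 0)"
    using measurable_W[OF s] by (intro integral_cong_AE) auto
  moreover have "(LINT \<omega>|N. ?V \<omega> * W s \<omega>) = (\<Sum>t\<in>J. c t * (LINT \<omega>|N. W t \<omega> * W s \<omega>))"
    using integrable_W_mult s J unfolding sum_distrib_right mult.assoc
    by (subst Bochner_Integration.integral_sum) (auto intro!: integrable_mult_right)
  moreover have "\<dots> = (\<Sum>t\<in>J. c t * fBm_covariance (2 * H) t s)"
    using J s by (intro sum.cong) (auto simp: expectation_W_mult subset_eq)
  ultimately show ?thesis by simp
qed

lemma char_scaled_combination:
  assumes L: "mixing_law L \<phi>" and [measurable]: "Y \<in> borel_measurable N" and Y: "distr N borel Y = L"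
    and indep: "independent_of N borel Y (Pi\<^sub>M {0..} (\<lambda>_. borel)) (\<lambda>\<omega>. \<lambda>t\<in>{0..}. W t \<omega>)"
    and J: "finite J" "J \<subseteq> {0..}"
  shows "(CLINT \<omega>|N. iexp (\<Sum>t\<in>J. c t * (sqrt (Y \<omega>) * W t \<omega>))) =
    complex_of_real (\<phi> ((\<Sum>s\<in>J. \<Sum>t\<in>J. c s * c t * fBm_covariance (2 * H) s t) / 2))"
proof -
  interpret L: mixing_law L \<phi> by fact
  let ?V = "\<lambda>\<omega>. \<Sum>t\<in>J. c t * W t \<omega>"
  define v where "v = (\<Sum>s\<in>J. \<Sum>t\<in>J. c s * c t * fBm_covariance (2 * H) s t)"
  have v: "0 \<le> v" "distr N borel ?V = normal_law 0 (sqrt v)"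
    unfolding v_def by (rule distr_combination[OF J])+
  interpret G: prob_space "normal_law 0 (sqrt v)" by (rule prob_space_normal_law) (use v in simp)
  interpret LG: pair_prob_space L "normal_law 0 (sqrt v)" ..
  have V[measurable]: "?V \<in> borel_measurable N"
    using J measurable_W by (intro borel_measurable_sum borel_measurable_times) auto
  \<comment> \<open>The combination is a measurable functional of the whole path, so independence of
    Y from the path passes to it and the joint law is a product.\<close>
  let ?h = "\<lambda>x :: real \<Rightarrow> real. \<Sum>t\<in>J. c t * x t"
  have h: "?h \<in> borel_measurable (Pi\<^sub>M {0..} (\<lambda>_. borel))"
    using J by (intro borel_measurable_sum borel_measurable_times measurable_component_singleton) auto
  have joint: "distr N (borel \<Otimes>\<^sub>M borel) (\<lambda>\<omega>. (Y \<omega>, ?V \<omega>)) = L \<Otimes>\<^sub>M normal_law 0 (sqrt v)"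
  proof (rule pair_measure_eqI[symmetric])
    show "sigma_finite_measure L" "sigma_finite_measure (normal_law 0 (sqrt v))" by unfold_locales
    show "sets (L \<Otimes>\<^sub>M normal_law 0 (sqrt v)) = sets (distr N (borel \<Otimes>\<^sub>M borel) (\<lambda>\<omega>. (Y \<omega>, ?V \<omega>)))"
      by (simp add: L.sets_L cong: sets_pair_measure_cong)
    fix A B assume "A \<in> sets L" "B \<in> sets (normal_law 0 (sqrt v))"
    then have AB[measurable]: "A \<in> sets borel" "B \<in> sets borel" by (simp_all add: L.sets_L)
    let ?a = "Y -` A \<inter> space N" and ?b = "?V -` B \<inter> space N"
    have b: "?b = (\<lambda>\<omega>. \<lambda>t\<in>{0..}. W t \<omega>) -` (?h -` B \<inter> space (Pi\<^sub>M {0..} (\<lambda>_. borel))) \<inter> space N"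
    proof -
      have "?h (\<lambda>t\<in>{0..}. W t \<omega>) = ?V \<omega>" for \<omega>
        using J by (intro sum.cong) auto
      then show ?thesis by (auto simp: space_PiM)
    qed
    have "prob (?a \<inter> ?b) = prob ?a * prob ?b"
      using indep measurable_sets[OF h AB(2)] AB(1)
      unfolding independent_of_def indep_sets2_eq b by blast
    then have "emeasure N (?a \<inter> ?b) = emeasure N ?a * emeasure N ?b"
      by (simp add: emeasure_eq_measure ennreal_mult')
    moreover have "emeasure L A = emeasure N ?a" "emeasure (normal_law 0 (sqrt v)) B = emeasure N ?b"
      unfolding Y[symmetric] v(2)[symmetric] by (auto simp: emeasure_distr)
    moreover have "emeasure (distr N (borel \<Otimes>\<^sub>M borel) (\<lambda>\<omega>. (Y \<omega>, ?V \<omega>))) (A \<times> B) = emeasure N (?a \<inter> ?b)"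
      by (subst emeasure_distr) (auto intro!: arg_cong[where f="emeasure N"])
    ultimately show "emeasure L A * emeasure (normal_law 0 (sqrt v)) B =
      emeasure (distr N (borel \<Otimes>\<^sub>M borel) (\<lambda>\<omega>. (Y \<omega>, ?V \<omega>))) (A \<times> B)" by simp
  qed
  have "(CLINT \<omega>|N. iexp (\<Sum>t\<in>J. c t * (sqrt (Y \<omega>) * W t \<omega>))) =
    (CLINT \<omega>|N. iexp (sqrt (Y \<omega>) * ?V \<omega>))"
    by (simp add: sum_distrib_left mult_ac)
  also have "\<dots> = (CLINT p|L \<Otimes>\<^sub>M normal_law 0 (sqrt v). iexp (sqrt (fst p) * snd p))"
    unfolding joint[symmetric] by (subst integral_distr) auto
  also have "\<dots> = (CLINT y|L. CLINT x|normal_law 0 (sqrt v). iexp (sqrt y * x))"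
    by (subst LG.integral_fst'[symmetric]) (auto intro!: LG.P.integrable_const_bound[where B=1])
  also have "\<dots> = (CLINT y|L. complex_of_real (exp (- (v / 2 * y))))"
  proof (rule integral_cong_AE)
    \<comment> \<open>Given y > 0, \<open>sqrt y\<close> times the combination is centred normal
      with variance v y; integrating over y gives the Laplace transform at v / 2.\<close>
    have "(CLINT x|normal_law 0 (sqrt v). iexp (sqrt y * x)) = complex_of_real (exp (- (v / 2 * y)))"
      if "0 < y" for y
      using that v(1) by (subst char_normal_law) (auto simp: power_mult_distrib)
    then show "AE y in L. (CLINT x|normal_law 0 (sqrt v). iexp (sqrt y * x)) = complex_of_real (exp (- (v / 2 * y)))"
      using L.pos by auto
  qed measurable
  also have "\<dots> = complex_of_real (\<phi> (v / 2))"
    by (subst L.laplace[symmetric], use v in simp, rule integral_complex_of_real)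
  finally show ?thesis by (simp add: v_def)
qed

end

section \<open>Grey Brownian motion\<close>

lemma mittag_leffler_one: "mittag_leffler 1 x = exp x"
proof -
  have "x ^ n / Gamma (1 * real n + 1) = x ^ n /\<^sub>R fact n" for n
    using Gamma_fact[of n, where 'a=real] by (simp add: add.commute divide_inverse)
  then show ?thesis by (simp only: mittag_leffler_def exp_def)
qed

text \<open>For \<beta> = 1 the transform is \<open>exp (- s)\<close>, that of the point mass at 1.
  For \<beta> < 1 it is part of the definition of the density, and 0 has no mass because it is
  Lebesgue-null.\<close>

lemma mixing_law_M_Wright:
  assumes "\<beta> \<le> 1" "\<beta> < 1 \<Longrightarrow> M_Wright_density \<beta> m" "prob_space (M_Wright_law \<beta> m)"
  shows "mixing_law (M_Wright_law \<beta> m) (\<lambda>s. mittag_leffler \<beta> (- s))"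
proof -
  interpret prob_space "M_Wright_law \<beta> m" by fact
  show ?thesis
  proof (cases "\<beta> = 1")
    case True
    then have L: "M_Wright_law \<beta> m = return borel 1"
      by (simp add: M_Wright_law_def)
    show ?thesis
    proof
      show "sets (M_Wright_law \<beta> m) = sets borel" by (simp add: L)
      show "AE y in M_Wright_law \<beta> m. 0 < y" unfolding L by (subst AE_return) auto
      show "(LINT y|M_Wright_law \<beta> m. exp (- (s * y))) = mittag_leffler \<beta> (- s)" for s
        unfolding L by (subst integral_return) (auto simp: True mittag_leffler_one)
    qed
  next
    case False
    define f where "f \<tau> = indicator {0..} \<tau> * m \<tau>" for \<tau>
    have M: "M_Wright_density \<beta> m" using assms False by simp
    have [measurable]: "m \<in> borel_measurable borel" and m: "\<And>\<tau>. 0 \<le> \<tau> \<Longrightarrow> 0 \<le> m \<tau>"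
      and lap: "\<And>s. 0 \<le> s \<Longrightarrow> has_bochner_integral lborel
        (\<lambda>\<tau>. indicator {0..} \<tau> * (exp (- (s * \<tau>)) * m \<tau>)) (mittag_leffler \<beta> (- s))"
      using M unfolding M_Wright_density_def by blast+
    have nn: "0 \<le> f \<tau>" for \<tau>
      by (simp add: f_def indicator_def m)
    have [measurable]: "f \<in> borel_measurable borel" unfolding f_def by measurable
    have "(\<lambda>\<tau>. indicator {0..} \<tau> * ennreal (m \<tau>)) = (\<lambda>\<tau>. ennreal (f \<tau>))"
      by (simp add: f_def indicator_def fun_eq_iff)
    then have L: "M_Wright_law \<beta> m = density lborel (\<lambda>\<tau>. ennreal (f \<tau>))"
      using False by (simp add: M_Wright_law_def)
    show ?thesis
    proof
      show "sets (M_Wright_law \<beta> m) = sets borel" by (simp add: L)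
      have "AE \<tau> in lborel. ennreal (f \<tau>) > 0 \<longrightarrow> 0 < \<tau>"
        using AE_lborel_singleton[of "0::real"]
        by eventually_elim (auto simp: f_def indicator_def split: if_splits)
      then show "AE y in M_Wright_law \<beta> m. 0 < y"
        unfolding L by (subst AE_density) auto
      show "(LINT y|M_Wright_law \<beta> m. exp (- (s * y))) = mittag_leffler \<beta> (- s)" if "0 \<le> s" for s
      proof -
        have "(LINT y|M_Wright_law \<beta> m. exp (- (s * y))) = (LINT y|lborel. f y * exp (- (s * y)))"
          unfolding L by (subst integral_density) (auto simp: nn)
        also have "\<dots> = mittag_leffler \<beta> (- s)"
          using has_bochner_integral_integral_eq[OF lap[OF that]] by (simp add: f_def mult_ac)
        finally show ?thesis .
      qed
    qed
  qed
qed

section \<open>The sampled vector and its covariance matrix\<close>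

lemma sum_range_inv:
  fixes \<tau> :: "'n::finite \<Rightarrow> 'b" and f :: "'b \<Rightarrow> real"
  assumes "inj \<tau>"
  shows "(\<Sum>s\<in>range \<tau>. \<theta> (inv \<tau> s) * f s) = (\<Sum>i\<in>UNIV. \<theta> i * f (\<tau> i))"
  using assms by (simp add: sum.reindex)

text \<open>Vectors are indexed by the type \<open>'n\<close>, combinations of the process by sets
  of times. As distinct indices have distinct times, \<open>inv (($) t)\<close> carries coefficients
  from one indexing to the other.\<close>

lemma quadratic_form_covariance_matrix:
  fixes t :: "real ^ 'n"
  assumes "inj (($) t)"
  shows "(\<Sum>s\<in>range (($) t). \<Sum>r\<in>range (($) t). \<theta> $ inv (($) t) s * \<theta> $ inv (($) t) r * fBm_covariance \<alpha> s r) =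
    \<theta> \<bullet> (covariance_matrix \<alpha> t *v \<theta>)"
  using assms
  by (simp add: sum.reindex inner_vec_def matrix_vector_mult_def covariance_matrix_def sum_distrib_left mult_ac)

lemma fBm_covariance_commute: "fBm_covariance \<alpha> s t = fBm_covariance \<alpha> t s"
  by (simp add: fBm_covariance_def abs_minus_commute add.commute)

text \<open>Positivity comes from the process: the quadratic form is the variance of a linear
  combination of its values.\<close>

lemma (in fBm) positive_semidefinite_covariance_matrix:
  fixes t :: "real ^ 'n"
  assumes "inj (($) t)" "\<And>i. 0 \<le> t $ i"
  shows "positive_semidefinite (covariance_matrix (2 * H) t)"
  unfolding positive_semidefinite_def
proof (intro conjI allI)
  show "transpose (covariance_matrix (2 * H) t) = covariance_matrix (2 * H) t"
    by (simp add: transpose_def covariance_matrix_def fBm_covariance_commute)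
  fix x :: "real ^ 'n"
  show "0 \<le> x \<bullet> (covariance_matrix (2 * H) t *v x)"
    unfolding quadratic_form_covariance_matrix[OF assms(1), symmetric]
    by (rule distr_combination(1)) (use assms in auto)
qed

lemma (in fBm) positive_definite_covariance_matrix:
  fixes t :: "real ^ 'n"
  assumes inj: "inj (($) t)" and pos: "\<And>i. 0 < t $ i" and H: "0 < H" "H < 1"
  shows "positive_definite (covariance_matrix (2 * H) t)"
proof -
  have psd: "positive_semidefinite (covariance_matrix (2 * H) t)"
    by (rule positive_semidefinite_covariance_matrix[OF inj]) (use pos less_imp_le in blast)
  have "x = 0" if zero: "x \<bullet> (covariance_matrix (2 * H) t *v x) = 0" for x
  proof -
    have "(\<Sum>i\<in>UNIV. x $ i * fBm_covariance (2 * H) (t $ i) s) = 0" if "0 \<le> s" for s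
    proof -
      have "(\<Sum>r\<in>range (($) t). x $ inv (($) t) r * fBm_covariance (2 * H) r s) = 0"
        by (rule degenerate_combination)
           (use zero that pos less_imp_le in \<open>auto simp: quadratic_form_covariance_matrix[OF inj]\<close>)
      then show ?thesis by (simp only: sum_range_inv[OF inj, of "($) x"])
    qed
    then have "x $ k = 0" for k
      using fBm_covariance_independent[of "2 * H" UNIV "($) t" "($) x" k] H inj pos by simp
    then show "x = 0" by (simp add: vec_eq_iff)
  qed
  then show ?thesis
    using psd unfolding positive_semidefinite_def positive_definite_def by (metis less_eq_real_def)
qed

lemma borel_measurable_sample_vector:
  assumes "\<And>s. 0 \<le> s \<Longrightarrow> B s \<in> borel_measurable P" "\<And>i. 0 \<le> t $ i"
  shows "sample_vector B t \<in> borel_measurable P"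
  unfolding sample_vector_def[abs_def] borel_measurable_euclidean_space[of "\<lambda>\<omega>. \<chi> i. B (t $ i) \<omega>"]
  using assms by (auto simp: Basis_vec_def inner_axis)

text \<open>The scalar product with \<theta> is a measurable function of the path restricted to the
  sampled times, so equality of finite-dimensional laws moves the computation to the representing
  space N.\<close>

lemma char_sample_vector:
  fixes t :: "real ^ 'n"
  assumes grey: "grey_Brownian_motion \<alpha> \<beta> m P B N Y W"
    and L: "mixing_law (M_Wright_law \<beta> m) \<phi>"
    and inj: "inj (($) t)" and nn: "\<And>i. 0 \<le> t $ i"
  shows "(CLINT \<omega>|P. iexp (\<theta> \<bullet> sample_vector B t \<omega>)) =
    complex_of_real (\<phi> (\<theta> \<bullet> (covariance_matrix \<alpha> t *v \<theta>) / 2))"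
proof -
  have g: "prob_space N" "fractional_Brownian_motion (\<alpha> / 2) N W"
    and B: "\<And>s. 0 \<le> s \<Longrightarrow> B s \<in> borel_measurable P"
    and Y[measurable]: "Y \<in> borel_measurable N" and dY: "distr N borel Y = M_Wright_law \<beta> m"
    and indep: "independent_of N borel Y (Pi\<^sub>M {0..} (\<lambda>_. borel)) (\<lambda>\<omega>. \<lambda>t\<in>{0..}. W t \<omega>)"
    and fdd: "same_finite_dim_distributions P B N (\<lambda>t \<omega>. sqrt (Y \<omega>) * W t \<omega>)"
    using grey by (auto simp: grey_Brownian_motion_def)
  interpret F: fBm N "\<alpha> / 2" W
    by (intro fBm.intro fBm_axioms.intro g)
  define J where "J = range (($) t)"
  have J: "finite J" "J \<subseteq> {0..}" using nn by (auto simp: J_def)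
  define c where "c s = \<theta> $ inv (($) t) s" for s
  let ?h = "\<lambda>x :: real \<Rightarrow> real. \<Sum>s\<in>J. c s * x s"
  have h[measurable]: "?h \<in> borel_measurable (Pi\<^sub>M J (\<lambda>_. borel))"
    by (intro borel_measurable_sum borel_measurable_times measurable_component_singleton) auto
  \<comment> \<open>Stated for an arbitrary type \<open>'z\<close>, because it is applied to P and
    to N, whose sample spaces have different types.\<close>
  have push: "(CLINT x|distr M (Pi\<^sub>M J (\<lambda>_. borel)) (\<lambda>\<omega>. \<lambda>t\<in>J. V t \<omega>). iexp (?h x)) =
    (CLINT \<omega>|M. iexp (\<Sum>s\<in>J. c s * V s \<omega>))" if V: "\<And>s. s \<in> J \<Longrightarrow> V s \<in> borel_measurable M"
    for M :: "'z measure" and V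
  proof -
    have "(CLINT x|distr M (Pi\<^sub>M J (\<lambda>_. borel)) (\<lambda>\<omega>. \<lambda>t\<in>J. V t \<omega>). iexp (?h x)) =
      (CLINT \<omega>|M. iexp (?h (\<lambda>t\<in>J. V t \<omega>)))"
      using V by (intro integral_distr measurable_restrict) auto
    also have "\<dots> = (CLINT \<omega>|M. iexp (\<Sum>s\<in>J. c s * V s \<omega>))"
    proof -
      have "?h (\<lambda>t\<in>J. V t \<omega>) = (\<Sum>s\<in>J. c s * V s \<omega>)" for \<omega>
        by (intro sum.cong) auto
      then show ?thesis by (simp only:)
    qed
    finally show ?thesis .
  qed
  have "(CLINT \<omega>|P. iexp (\<theta> \<bullet> sample_vector B t \<omega>)) = (CLINT \<omega>|P. iexp (\<Sum>s\<in>J. c s * B s \<omega>))"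
    unfolding J_def c_def sum_range_inv[OF inj, of "($) \<theta>"] by (simp add: inner_vec_def sample_vector_def)
  also have "\<dots> = (CLINT x|distr P (Pi\<^sub>M J (\<lambda>_. borel)) (\<lambda>\<omega>. \<lambda>t\<in>J. B t \<omega>). iexp (?h x))"
    using B J by (intro push[symmetric]) auto
  also have "distr P (Pi\<^sub>M J (\<lambda>_. borel)) (\<lambda>\<omega>. \<lambda>t\<in>J. B t \<omega>) =
      distr N (Pi\<^sub>M J (\<lambda>_. borel)) (\<lambda>\<omega>. \<lambda>t\<in>J. sqrt (Y \<omega>) * W t \<omega>)"
    using fdd J by (auto simp: same_finite_dim_distributions_def)
  also have "(CLINT x|\<dots>. iexp (?h x)) = (CLINT \<omega>|N. iexp (\<Sum>s\<in>J. c s * (sqrt (Y \<omega>) * W s \<omega>)))"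
    using F.measurable_W J by (intro push) auto
  also have "\<dots> = complex_of_real (\<phi> ((\<Sum>s\<in>J. \<Sum>t\<in>J. c s * c t * fBm_covariance (2 * (\<alpha> / 2)) s t) / 2))"
    by (rule F.char_scaled_combination[OF L Y dY indep J])
  also have "(\<Sum>s\<in>J. \<Sum>t\<in>J. c s * c t * fBm_covariance (2 * (\<alpha> / 2)) s t) = \<theta> \<bullet> (covariance_matrix \<alpha> t *v \<theta>)"
    unfolding J_def c_def using quadratic_form_covariance_matrix[OF inj, of \<theta> \<alpha>] by simp
  finally show ?thesis .
qed

text \<open>If \<open>transpose A\<close> identified two vectors, the quadratic form would vanish at
  their difference; so \<open>transpose A\<close> is injective, and A is invertible.\<close>

lemma positive_definite_factor_inverse:
  fixes A :: "real ^ 'n ^ 'n"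
  assumes "positive_definite (A ** transpose A)"
  obtains A' where "A ** A' = mat 1" "A' ** A = mat 1"
proof -
  have "x = y" if eq: "transpose A *v x = transpose A *v y" for x y
  proof (rule ccontr)
    assume "x \<noteq> y"
    then have "0 < (x - y) \<bullet> ((A ** transpose A) *v (x - y))"
      using assms by (simp add: positive_definite_def)
    also have "(A ** transpose A) *v (x - y) = 0"
      using eq by (simp add: matrix_vector_mul_assoc[symmetric] matrix_vector_mult_diff_distrib)
    finally show False by simp
  qed
  then have "inj ((*v) (transpose A))" by (rule injI)
  then obtain C where "C ** transpose A = mat 1"
    using matrix_left_invertible_injective by blast
  then have "A ** transpose C = mat 1"
    by (metis matrix_transpose_mul transpose_mat transpose_transpose)
  then show thesis
    using that matrix_left_right_inverse by blast
qed

text \<open>At z = 0 both sides are 0, so the polar form can be recomposed at every point, without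
  an exceptional null set.\<close>

lemma norm_scaleR_matrix_direction:
  fixes A :: "real ^ 'n ^ 'm"
  shows "norm z *\<^sub>R (A *v (z /\<^sub>R norm z)) = A *v z"
  by (cases "z = 0") (simp_all add: matrix_vector_mult_scaleR)

section \<open>Density and polar representation of the sample\<close>

context mixing_law
begin

lemma density_generator_linear_gaussian_mixture:
  fixes A :: "real ^ 'n ^ 'n"
  assumes S: "positive_definite (A ** transpose A)" and [measurable]: "X \<in> borel_measurable P"
    and X: "distr P borel X = distr (gaussian_mixture L) borel ((*v) A)"
  shows "density_generator P X 0 (A ** transpose A) (generator CARD('n))"
proof -
  let ?S = "A ** transpose A"
  obtain A' where inv: "A ** A' = mat 1" "A' ** A = mat 1"
    by (rule positive_definite_factor_inverse[OF S])
  have T: "transpose A' ** transpose A = mat 1" "transpose A ** transpose A' = mat 1"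
    by (simp_all add: matrix_transpose_mul[symmetric] inv transpose_mat)
  have SI: "?S ** (transpose A' ** A') = mat 1"
  proof -
    have "?S ** (transpose A' ** A') = A ** (transpose A ** transpose A') ** A'"
      by (simp add: matrix_mul_assoc)
    then show ?thesis by (simp add: T inv)
  qed
  then have IS: "(transpose A' ** A') ** ?S = mat 1"
    using matrix_left_right_inverse by blast
  \<comment> \<open>\<open>matrix_inv\<close> is a choice among two-sided inverses; exhibiting one
    makes the left-inverse law available, and associativity then identifies the chosen
    matrix.\<close>
  have left: "matrix_inv ?S ** ?S = mat 1"
    unfolding matrix_inv_def using SI IS by (rule someI2[of _ "transpose A' ** A'", OF conjI]) simp
  have "matrix_inv ?S = matrix_inv ?S ** (?S ** (transpose A' ** A'))"
    by (simp add: SI)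
  also have "\<dots> = transpose A' ** A'"
    by (subst matrix_mul_assoc) (simp only: left matrix_mul_lid)
  finally have inv_S: "matrix_inv ?S = transpose A' ** A'" .
  have quad: "x \<bullet> (matrix_inv ?S *v x) = (norm (A' *v x))\<^sup>2" for x
    unfolding inv_S
    by (simp add: power2_norm_eq_inner matrix_vector_mul_assoc[symmetric] dot_lmul_matrix[symmetric]
        transpose_matrix_vector inner_commute)
  have "invertible ?S" using SI IS by (auto simp: invertible_def)
  then have det: "sqrt (det ?S) \<noteq> 0" by (simp add: invertible_det_nz)
  obtain k where k: "0 \<le> k" "distr (gaussian_mixture L) borel ((*v) A) =
    density lborel (\<lambda>x. ennreal k * generator CARD('n) ((norm (A' *v x))\<^sup>2 / 2))"
    by (rule linear_gaussian_mixture_density[OF inv])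
  \<comment> \<open>The witness \<open>k * sqrt (det ?S)\<close> for the constant cancels the
    normalisation by the nonzero \<open>sqrt (det ?S)\<close>.\<close>
  have "distributed P lborel X (\<lambda>x. ennreal (k * sqrt (det ?S) / sqrt (det ?S)) *
      generator CARD('n) ((x - 0) \<bullet> (matrix_inv ?S *v (x - 0)) / 2))"
    unfolding distributed_def
  proof (intro conjI)
    show "distr P lborel X = density lborel (\<lambda>x. ennreal (k * sqrt (det ?S) / sqrt (det ?S)) *
        generator CARD('n) ((x - 0) \<bullet> (matrix_inv ?S *v (x - 0)) / 2))"
      using det X k(2) by (simp add: quad cong: distr_cong)
  qed (simp_all add: quad)
  then show ?thesis unfolding density_generator_def by blast
qed

end
text \<open>At positive times A is invertible and the polar representation holds almost surely on P.
  A sample at time 0 makes A singular, so the direction cannot be recovered by inverting A; the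
  representation that covers this case too is an equality of laws.\<close>

theorem mainTheorem5:
  fixes \<alpha> \<beta> :: real and m :: "real \<Rightarrow> real"
    and P :: "'a measure" and B :: "real \<Rightarrow> 'a \<Rightarrow> real"
    and N :: "'b measure" and Y :: "'b \<Rightarrow> real" and W :: "real \<Rightarrow> 'b \<Rightarrow> real"
    and t :: "real ^ 'n::{finite, linorder}"
  assumes "0 < \<alpha>" and "\<alpha> < 2" and "0 < \<beta>" and "\<beta> \<le> 1"
    and "\<beta> < 1 \<Longrightarrow> M_Wright_density \<beta> m"
    and "grey_Brownian_motion \<alpha> \<beta> m P B N Y W"
    and "\<forall>i. 0 \<le> t $ i" and "strict_mono (\<lambda>i. t $ i)"
  shows "let X = sample_vector B t;
             S = covariance_matrix \<alpha> t;
             \<phi> = (\<lambda>x. mittag_leffler \<beta> (- x));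
             n = CARD('n);
             g = grey_density_generator n \<beta> m
         in
           positive_semidefinite S \<and>
           characteristic_generator TYPE('n) \<phi> \<and>
           elliptical_char_function P X 0 S \<phi> \<and>
           ((\<forall>i. 0 < t $ i) \<longrightarrow>
              elliptical_distribution P X 0 S \<phi> \<and> density_generator P X 0 S g) \<and>
           (\<integral>\<^sup>+x\<in>{0..}. ennreal (x powr (real n / 2 - 1)) * g x \<partial>lborel) =
             ennreal ((2 * pi) powr (- (real n / 2)) * Gamma (real n / 2)) \<and>
           (\<integral>\<^sup>+x\<in>{0..}. ennreal (x powr (real n / 2 - 1)) * g x \<partial>lborel) < \<infinity> \<and>
           (\<exists>A :: ((real, 'n) vec, 'n) vec. S = A ** transpose A) \<and>
           (\<exists>(Q :: (real \<times> (real, 'n) vec) measure) R U. radial_uniform_pair Q R U \<and>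
              (\<forall>A :: ((real, 'n) vec, 'n) vec. S = A ** transpose A \<longrightarrow>
                 distr P borel X = distr Q borel (\<lambda>\<omega>. R \<omega> *\<^sub>R (A *v U \<omega>)))) \<and>
           ((\<forall>i. 0 < t $ i) \<longrightarrow>
              (\<forall>A :: ((real, 'n) vec, 'n) vec. S = A ** transpose A \<longrightarrow>
                 (\<exists>R U. radial_uniform_pair P R U \<and>
                    (AE \<omega> in P. X \<omega> = R \<omega> *\<^sub>R (A *v U \<omega>)))))"
proof -
  let ?X = "sample_vector B t" and ?S = "covariance_matrix \<alpha> t" and ?L = "M_Wright_law \<beta> m"
  let ?\<phi> = "\<lambda>x. mittag_leffler \<beta> (- x)"
  have inj: "inj (($) t)" using assms(8) by (rule strict_mono_imp_inj_on)
  have nn: "0 \<le> t $ i" for i using assms(7) by blast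
  have P: "prob_space P" and N: "prob_space N" and B: "\<And>s. 0 \<le> s \<Longrightarrow> B s \<in> borel_measurable P"
    and Y: "Y \<in> borel_measurable N" "distr N borel Y = ?L" and W: "fractional_Brownian_motion (\<alpha> / 2) N W"
    using assms(6) by (simp_all add: grey_Brownian_motion_def)
  interpret P: prob_space P by (rule P)
  interpret W: fBm N "\<alpha> / 2" W by (intro fBm.intro fBm_axioms.intro N W)
  have "prob_space ?L"
    unfolding Y(2)[symmetric] by (rule prob_space.prob_space_distr[OF N Y(1)])
  then have L: "mixing_law ?L ?\<phi>"
    using assms by (intro mixing_law_M_Wright) auto
  interpret L: mixing_law ?L ?\<phi> by (rule L)
  have gen: "grey_density_generator n \<beta> m = L.generator n" for n
    by (simp add: fun_eq_iff grey_density_generator_def L.generator_def)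
  have X[measurable]: "?X \<in> borel_measurable P"
    using B nn by (rule borel_measurable_sample_vector)
  have char: "(CLINT \<omega>|P. iexp (\<theta> \<bullet> ?X \<omega>)) = complex_of_real (?\<phi> (\<theta> \<bullet> (?S *v \<theta>) / 2))" for \<theta>
    using char_sample_vector[OF assms(6) L inj nn] .
  have psd: "positive_semidefinite ?S"
    using W.positive_semidefinite_covariance_matrix[OF inj nn] by simp
  have pd: "positive_definite ?S" if "\<forall>i. 0 < t $ i"
    using W.positive_definite_covariance_matrix[OF inj] that assms(1,2) by simp
  have law: "distr P borel ?X = distr (gaussian_mixture ?L) borel ((*v) A)"
    if A: "?S = A ** transpose A" for A :: "((real, 'n) vec, 'n) vec"
  proof (rule L.eq_linear_gaussian_mixture)
    show "prob_space (distr P borel ?X)" by (rule P.prob_space_distr) simp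
    show "(CLINT x|distr P borel ?X. iexp (\<theta> \<bullet> x)) =
        complex_of_real (?\<phi> (\<theta> \<bullet> ((A ** transpose A) *v \<theta>) / 2))" for \<theta>
      unfolding A[symmetric] char[symmetric] by (rule integral_distr) auto
  qed simp
  have elliptical: "elliptical_char_function P ?X 0 ?S ?\<phi>"
    using char X by (simp add: elliptical_char_function_def)
  obtain A0 :: "((real, 'n) vec, 'n) vec" where A0: "?S = A0 ** transpose A0"
    using positive_semidefinite_factor[OF psd] by blast
  have density: "density_generator P ?X 0 ?S (L.generator CARD('n))" if "\<forall>i. 0 < t $ i"
    using L.density_generator_linear_gaussian_mixture[of A0 ?X P] pd[OF that] law[OF A0] X by (simp add: A0)
  have integral: "(\<integral>\<^sup>+x\<in>{0..}. ennreal (x powr (real CARD('n) / 2 - 1)) * L.generator CARD('n) x \<partial>lborel) =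
      ennreal ((2 * pi) powr (- (real CARD('n) / 2)) * Gamma (real CARD('n) / 2))"
    by (rule L.nn_integral_generator) simp
  have representation: "\<exists>(Q :: (real \<times> (real, 'n) vec) measure) R U. radial_uniform_pair Q R U \<and>
      (\<forall>A :: ((real, 'n) vec, 'n) vec. ?S = A ** transpose A \<longrightarrow>
         distr P borel ?X = distr Q borel (\<lambda>\<omega>. R \<omega> *\<^sub>R (A *v U \<omega>)))"
  proof (intro exI conjI allI impI)
    \<comment> \<open>The pair is the norm and direction of \<open>sqrt y *\<^sub>R z\<close> on the
      product space. It is built before A is chosen, so one pair serves all factors.\<close>
    let ?Q = "?L \<Otimes>\<^sub>M (std_gaussian :: ((real, 'n) vec) measure)"
    let ?Z = "\<lambda>(y, z). sqrt y *\<^sub>R z :: (real, 'n) vec"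
    have Z: "?Z \<in> borel_measurable ?Q" by measurable
    show "radial_uniform_pair ?Q (\<lambda>\<omega>. norm (?Z \<omega>)) (\<lambda>\<omega>. ?Z \<omega> /\<^sub>R norm (?Z \<omega>))"
      by (rule L.radial_uniform_pair_gaussian_mixture[OF L.LG.P.prob_space_axioms Z])
         (simp add: gaussian_mixture_def)
    fix A :: "((real, 'n) vec, 'n) vec" assume A: "?S = A ** transpose A"
    have "norm (?Z \<omega>) *\<^sub>R (A *v (?Z \<omega> /\<^sub>R norm (?Z \<omega>))) = A *v ?Z \<omega>" for \<omega>
      by (rule norm_scaleR_matrix_direction)
    then show "distr P borel ?X = distr ?Q borel (\<lambda>\<omega>. norm (?Z \<omega>) *\<^sub>R (A *v (?Z \<omega> /\<^sub>R norm (?Z \<omega>))))"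
      unfolding law[OF A] gaussian_mixture_def by (subst distr_distr[OF _ Z]) (simp_all add: comp_def)
  qed
  have pathwise: "\<exists>R U. radial_uniform_pair P R U \<and> (AE \<omega> in P. ?X \<omega> = R \<omega> *\<^sub>R (A *v U \<omega>))"
    if pos: "\<forall>i. 0 < t $ i" and A: "?S = A ** transpose A" for A :: "((real, 'n) vec, 'n) vec"
  proof -
    obtain A' where inv: "A ** A' = mat 1" "A' ** A = mat 1"
      using positive_definite_factor_inverse[of A] pd[OF pos] A by metis
    \<comment> \<open>Undoing A gives a variable on P itself with the mixture law; its norm and
      direction are R and U.\<close>
    let ?Z = "\<lambda>\<omega>. A' *v ?X \<omega>"
    have Z: "?Z \<in> borel_measurable P" by measurable
    have "distr P borel ?Z = distr (distr P borel ?X) borel ((*v) A')"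
      by (subst distr_distr) (simp_all add: comp_def)
    also have "\<dots> = distr (gaussian_mixture ?L) borel (\<lambda>x. x)"
      unfolding law[OF A] by (subst distr_distr) (simp_all add: comp_def matrix_vector_mul_assoc inv)
    also have "\<dots> = gaussian_mixture ?L" by (rule distr_id2) simp
    finally have "radial_uniform_pair P (\<lambda>\<omega>. norm (?Z \<omega>)) (\<lambda>\<omega>. ?Z \<omega> /\<^sub>R norm (?Z \<omega>))"
      by (rule L.radial_uniform_pair_gaussian_mixture[OF P Z])
    moreover have "?X \<omega> = norm (?Z \<omega>) *\<^sub>R (A *v (?Z \<omega> /\<^sub>R norm (?Z \<omega>)))" for \<omega>
      unfolding norm_scaleR_matrix_direction by (simp add: matrix_vector_mul_assoc inv)
    ultimately show ?thesis by blast
  qed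
  have fin: "(\<integral>\<^sup>+x\<in>{0..}. ennreal (x powr (real CARD('n) / 2 - 1)) * L.generator CARD('n) x \<partial>lborel) < \<infinity>"
    unfolding integral by simp
  show ?thesis
    unfolding Let_def gen elliptical_distribution_def
    by (intro conjI allI impI psd L.characteristic_generator_mixture elliptical pd density integral fin
        exI[of _ A0] A0 representation pathwise) blast+
qed

end
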